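(* Let $n\ge 1$ and let $\zeta_6$ be a primitive sixth root of unity. The Frobenius characteristic of the natural action of $\mathfrak{S}_n$ on the set of regions of the semiorder arrangement $\mathcal{I}_n$ is $G_n(\mathsf{x};1,\zeta_6^{-1},1,\zeta_6)$.
   Context: The semiorder arrangement $\mathcal{I}_n$ is the hyperplane arrangement in $\mathbb{R}^n$ consisting of the hyperplanes $x_i-x_j=1$ for $1\le i\ne j\le n$. Its regions are the connected components of the complement of the union of the hyperplanes. $\mathfrak{S}_n$ acts on $\mathbb{R}^n$ by permuting coordinates, preserving the set of hyperplanes, and hence acts on the set of regions; the Frobenius characteristic of the action is that of the character of the corresponding permutation representation over $\mathbb{C}$. A (plane binary) tree is a rooted tree in which every node has at most one left child and at most one right child (it may have only one of the two), and no other children. A labeled tree is a tree whose nodes are labeled with positive integers, repetitions allowed; $\mathcal{T}^{\ell}_n$ is the set of labeled trees on $n$ nodes. Write $v^\ell$ for the label of $v$. If $v$ is the left child of $w$, the edge is a left ascent if $v^\ell\le w^\ell$ and a left descent otherwise. If $w$ is the right child of $v$, the edge is a right ascent if $v^\ell\le w^\ell$ and a right descent otherwise. $\mathrm{lasc},\mathrm{ldes},\mathrm{rasc},\mathrm{rdes}$ count these edges. With $\mathsf{x}^T=\prod_{v\in T}x_{v^\ell}$, $$G_n(\mathsf{x};\bar\lambda,\lambda,\bar\rho,\rho)=\sum_{T\in\mathcal{T}^\ell_n}\bar\lambda^{\mathrm{lasc}(T)}\lambda^{\mathrm{ldes}(T)}\bar\rho^{\,\mathrm{rasc}(T)}\rho^{\,\mathrm{rdes}(T)}\,\mathsf{x}^T.$$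 *)

theory Defs
  imports
    "HOL-Analysis.Analysis"
    "HOL-Library.Tree_Multiset"
    "HOL-Combinatorics.Orbits"
begin

section \<open>Formal power series in infinitely many variables\<close>

text \<open>
  A monomial is a multiset of variable indices: the multiset \<open>{#i, i, j#}\<close> stands for
  $x_i^2 x_j$. The symmetric functions below only involve the variables $x_1, x_2, \ldots$;
  the index 0 is never used.
\<close>

typedef 'a mseries = "UNIV :: (nat multiset \<Rightarrow> 'a) set"
  morphisms coeff_at Abs_mseries
  by simp

setup_lifting type_definition_mseries

lemma mseries_eqI: "(\<And>m. coeff_at f m = coeff_at g m) \<Longrightarrow> f = g"
  by transfer blast

text \<open>The finitely many factorizations of a monomial into two monomials.\<close>

definition splits :: "'b multiset \<Rightarrow> ('b multiset \<times> 'b multiset) set" where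
  "splits m = {(a, b). a + b = m}"

lemma splits_altdef: "splits m = (\<lambda>a. (a, m - a)) ` {a. a \<subseteq># m}"
  unfolding splits_def by force

lemma finite_splits [simp]: "finite (splits m)"
proof -
  have "finite {a. a \<subseteq># m}"
  proof (rule finite_subset)
    show "{a. a \<subseteq># m} \<subseteq> (\<Union>k\<le>size m. multisets_of_size (set_mset m) k)"
      using set_mset_mono size_mset_mono by (fastforce simp: multisets_of_size_def)
    show "finite (\<Union>k\<le>size m. multisets_of_size (set_mset m) k)"
      by auto
  qed
  thus ?thesis by (simp add: splits_altdef)
qed

instantiation mseries :: (comm_ring_1) comm_ring_1
begin

lift_definition zero_mseries :: "'a mseries" is "\<lambda>_. 0" .

lift_definition one_mseries :: "'a mseries" is "\<lambda>m. if m = {#} then 1 else 0" .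

lift_definition plus_mseries :: "'a mseries \<Rightarrow> 'a mseries \<Rightarrow> 'a mseries" is
  "\<lambda>f g m. f m + g m" .

lift_definition uminus_mseries :: "'a mseries \<Rightarrow> 'a mseries" is "\<lambda>f m. - f m" .

lift_definition minus_mseries :: "'a mseries \<Rightarrow> 'a mseries \<Rightarrow> 'a mseries" is
  "\<lambda>f g m. f m - g m" .

lift_definition times_mseries :: "'a mseries \<Rightarrow> 'a mseries \<Rightarrow> 'a mseries" is
  "\<lambda>f g m. \<Sum>(a, b)\<in>splits m. f a * g b" .

instance
proof
  fix f g h :: "'a mseries"
  show "f * g * h = f * (g * h)"
  proof transfer
    fix f g h :: "nat multiset \<Rightarrow> 'a"
    show "(\<lambda>m. \<Sum>(d, c)\<in>splits m. (\<Sum>(a, b)\<in>splits d. f a * g b) * h c)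
        = (\<lambda>m. \<Sum>(a, e)\<in>splits m. f a * (\<Sum>(b, c)\<in>splits e. g b * h c))"
    proof
      fix m
      have "(\<Sum>(d, c)\<in>splits m. (\<Sum>(a, b)\<in>splits d. f a * g b) * h c)
          = (\<Sum>p\<in>splits m. \<Sum>q\<in>splits (fst p). f (fst q) * g (snd q) * h (snd p))"
        by (simp add: case_prod_unfold sum_distrib_right)
      also have "\<dots> = (\<Sum>(p, q)\<in>(SIGMA p:splits m. splits (fst p)). f (fst q) * g (snd q) * h (snd p))"
        by (subst sum.Sigma) auto
      also have "\<dots> = (\<Sum>(p, q)\<in>(SIGMA p:splits m. splits (snd p)). f (fst p) * (g (fst q) * h (snd q)))"
        by (rule sum.reindex_bij_witness
              [where i = "\<lambda>(p, q). ((fst p + fst q, snd q), (fst p, fst q))"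
                 and j = "\<lambda>(p, q). ((fst q, snd q + snd p), (snd q, snd p))"])
           (auto simp: splits_def ac_simps)
      also have "\<dots> = (\<Sum>p\<in>splits m. \<Sum>q\<in>splits (snd p). f (fst p) * (g (fst q) * h (snd q)))"
        by (subst sum.Sigma) auto
      also have "\<dots> = (\<Sum>(a, e)\<in>splits m. f a * (\<Sum>(b, c)\<in>splits e. g b * h c))"
        by (simp add: case_prod_unfold sum_distrib_left)
      finally show "(\<Sum>(d, c)\<in>splits m. (\<Sum>(a, b)\<in>splits d. f a * g b) * h c)
          = (\<Sum>(a, e)\<in>splits m. f a * (\<Sum>(b, c)\<in>splits e. g b * h c))" .
    qed
  qed
  show "f * g = g * f"
  proof transfer
    fix f g :: "nat multiset \<Rightarrow> 'a"
    show "(\<lambda>m. \<Sum>(a, b)\<in>splits m. f a * g b) = (\<lambda>m. \<Sum>(a, b)\<in>splits m. g a * f b)"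
      by (intro ext sum.reindex_bij_witness[where i = prod.swap and j = prod.swap])
         (auto simp: splits_def ac_simps)
  qed
  show "1 * f = f"
  proof transfer
    fix f :: "nat multiset \<Rightarrow> 'a"
    show "(\<lambda>m. \<Sum>(a, b)\<in>splits m. (if a = {#} then 1 else 0) * f b) = f"
    proof
      fix m
      have "(\<Sum>(a, b)\<in>splits m. (if a = {#} then 1 else 0) * f b)
          = (\<Sum>(a, b)\<in>{({#} :: nat multiset, m)}. (if a = {#} then 1 else 0) * f b)"
        by (rule sum.mono_neutral_right[OF finite_splits]) (auto simp: splits_def split: if_splits)
      thus "(\<Sum>(a, b)\<in>splits m. (if a = {#} then 1 else 0) * f b) = f m" by simp
    qed
  qed
  show "(f + g) * h = f * h + g * h"
    by transfer (simp add: case_prod_unfold distrib_right sum.distrib)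
  show "(0::'a mseries) \<noteq> 1"
    by transfer (auto dest: fun_cong[where x = "{#}"])
qed (transfer; auto simp: algebra_simps)+

end

lift_definition scale_mseries :: "'a::comm_ring_1 \<Rightarrow> 'a mseries \<Rightarrow> 'a mseries" is
  "\<lambda>c f m. c * f m" .


section \<open>Frobenius characteristic\<close>

text \<open>The power sum $p_k = \sum_{i \ge 1} x_i^k$, for $k \ge 1$.\<close>

lift_definition power_sum :: "nat \<Rightarrow> 'a::comm_ring_1 mseries" is
  "\<lambda>k m. if \<exists>i\<ge>1. m = replicate_mset k i then 1 else 0" .

text \<open>
  Fixed points of the permutation in \<open>A\<close> count as cycles of length 1
  (\<open>orbit \<pi> i = {i}\<close> for those).
\<close>

definition cycle_type :: "'i set \<Rightarrow> ('i \<Rightarrow> 'i) \<Rightarrow> nat multiset" where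
  "cycle_type A \<pi> = image_mset card (mset_set (orbit \<pi> ` A))"

text \<open>
  $\mathrm{ch}(f) = \frac{1}{n!} \sum_{\pi} f(\pi)\, p_{\mathrm{cyc}(\pi)}$ for a class
  function on the symmetric group of a finite set \<open>A\<close> with $n$ elements.
\<close>

definition frobenius_characteristic ::
    "'i set \<Rightarrow> (('i \<Rightarrow> 'i) \<Rightarrow> complex) \<Rightarrow> complex mseries" where
  "frobenius_characteristic A f =
     scale_mseries (1 / fact (card A))
       (\<Sum>\<pi> | \<pi> permutes A. scale_mseries (f \<pi>) (\<Prod>k\<in>#cycle_type A \<pi>. power_sum k))"

text \<open>
  For an action on a finite set \<open>X\<close>, the matrix (with respect to the basis \<open>X\<close>) by which \<open>g\<close>
  acts on the space of formal complex linear combinations of elements of \<open>X\<close>, and its trace.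
\<close>

definition perm_rep_matrix :: "('g \<Rightarrow> 'x \<Rightarrow> 'x) \<Rightarrow> 'g \<Rightarrow> 'x \<Rightarrow> 'x \<Rightarrow> complex" where
  "perm_rep_matrix act g x y = (if x = act g y then 1 else 0)"

definition perm_rep_character :: "'x set \<Rightarrow> ('g \<Rightarrow> 'x \<Rightarrow> 'x) \<Rightarrow> 'g \<Rightarrow> complex" where
  "perm_rep_character X act g = (\<Sum>x\<in>X. perm_rep_matrix act g x x)"


section \<open>The semiorder arrangement\<close>

text \<open>
  The coordinates of $\mathbb{R}^n$ are indexed by a finite type \<open>'n\<close> with $n$ elements, and
  $\mathfrak{S}_n$ is the group of permutations of that type.
\<close>

definition semiorder_arrangement :: "(real ^ 'n) set set" where
  "semiorder_arrangement = {{x. x $ i - x $ j = 1} | i j. i \<noteq> j}"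

definition regions :: "'v::topological_space set set \<Rightarrow> 'v set set" where
  "regions H = components (- \<Union>H)"

text \<open>The inverse makes this a left action: $(\pi \cdot x)_{\pi(i)} = x_i$.\<close>

definition permute_coords :: "('n \<Rightarrow> 'n) \<Rightarrow> real ^ 'n \<Rightarrow> real ^ 'n" where
  "permute_coords \<pi> x = (\<chi> i. x $ inv \<pi> i)"

definition permute_region :: "('n \<Rightarrow> 'n) \<Rightarrow> (real ^ 'n) set \<Rightarrow> (real ^ 'n) set" where
  "permute_region \<pi> R = permute_coords \<pi> ` R"

lemma permute_coords_compose:
  assumes "bij \<pi>" "bij \<sigma>"
  shows "permute_coords (\<pi> \<circ> \<sigma>) x = permute_coords \<pi> (permute_coords \<sigma> x)"
  using assms by (simp add: permute_coords_def vec_eq_iff o_inv_distrib)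

lemma permute_region_compose:
  assumes "bij \<pi>" "bij \<sigma>"
  shows "permute_region (\<pi> \<circ> \<sigma>) R = permute_region \<pi> (permute_region \<sigma> R)"
  using assms by (simp add: permute_region_def image_image permute_coords_compose)

lemma permute_region_id: "permute_region id R = R"
  by (simp add: permute_region_def permute_coords_def)

lemma permute_region_regions:
  fixes R :: "(real ^ 'n) set"
  assumes \<pi>: "bij \<pi>" and R: "R \<in> regions semiorder_arrangement"
  shows "permute_region \<pi> R \<in> regions semiorder_arrangement"
proof -
  let ?C = "- \<Union>(semiorder_arrangement :: (real ^ 'n) set set)"
  have mem: "x \<in> ?C \<longleftrightarrow> (\<forall>i j. i \<noteq> j \<longrightarrow> x $ i - x $ j \<noteq> 1)" for x
    by (auto simp: semiorder_arrangement_def)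
  have pres: "permute_coords \<sigma> x \<in> ?C" if "bij \<sigma>" "x \<in> ?C" for \<sigma> x
    using that bij_imp_bij_inv[OF \<open>bij \<sigma>\<close>]
    unfolding mem by (auto simp: permute_coords_def bij_def inj_eq)
  have cont: "continuous_on S (permute_coords \<sigma>)" for S :: "(real ^ 'n) set" and \<sigma>
    unfolding permute_coords_def by (intro continuous_intros)
  have inv1: "permute_coords (inv \<pi>) (permute_coords \<pi> x) = x" for x
    using \<pi> by (simp add: permute_coords_def vec_eq_iff inv_inv_eq bij_is_inj)
  have inv2: "permute_coords \<pi> (permute_coords (inv \<pi>) x) = x" for x
    using \<pi> by (simp add: permute_coords_def vec_eq_iff inv_inv_eq bij_is_surj surj_f_inv_f)
  have homeo: "homeomorphism ?C ?C (permute_coords \<pi>) (permute_coords (inv \<pi>))"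
  proof (rule homeomorphismI)
    show "permute_coords \<pi> ` ?C \<subseteq> ?C"
      using pres[OF \<pi>] by blast
    show "permute_coords (inv \<pi>) ` ?C \<subseteq> ?C"
      using pres[OF bij_imp_bij_inv[OF \<pi>]] by blast
  qed (simp_all add: inv1 inv2 cont)
  obtain x where x: "x \<in> ?C" "R = connected_component_set ?C x"
    using R by (auto simp: regions_def components_def)
  have "permute_region \<pi> R = connected_component_set ?C (permute_coords \<pi> x)"
    unfolding permute_region_def x(2)
    using connected_component_set_homeomorphism[OF homeo x(1)] by simp
  thus ?thesis
    using pres[OF \<pi> x(1)] unfolding regions_def components_def by blast
qed


section \<open>Labeled plane binary trees\<close>

text \<open>
  \<open>Leaf\<close> is the empty tree, i.e. an absent child; the nodes of a tree are its
  \<open>Node\<close> constructors, and \<open>size\<close> counts them.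
\<close>

definition labeled_trees :: "nat \<Rightarrow> nat tree set" where
  "labeled_trees n = {T. size T = n \<and> (\<forall>a\<in>set_tree T. a \<ge> 1)}"

fun lasc :: "nat tree \<Rightarrow> nat" where
  "lasc Leaf = 0"
| "lasc (Node l w r) =
     lasc l + lasc r + (case l of Leaf \<Rightarrow> 0 | Node _ v _ \<Rightarrow> if v \<le> w then 1 else 0)"

fun ldes :: "nat tree \<Rightarrow> nat" where
  "ldes Leaf = 0"
| "ldes (Node l w r) =
     ldes l + ldes r + (case l of Leaf \<Rightarrow> 0 | Node _ v _ \<Rightarrow> if v \<le> w then 0 else 1)"

fun rasc :: "nat tree \<Rightarrow> nat" where
  "rasc Leaf = 0"
| "rasc (Node l v r) =
     rasc l + rasc r + (case r of Leaf \<Rightarrow> 0 | Node _ w _ \<Rightarrow> if v \<le> w then 1 else 0)"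

fun rdes :: "nat tree \<Rightarrow> nat" where
  "rdes Leaf = 0"
| "rdes (Node l v r) =
     rdes l + rdes r + (case r of Leaf \<Rightarrow> 0 | Node _ w _ \<Rightarrow> if v \<le> w then 0 else 1)"

text \<open>
  The sum over all labeled trees is infinite, so it is written coefficientwise: only finitely
  many trees \<open>T\<close> contribute a given monomial, and the monomial $\mathsf{x}^T$ is the multiset
  \<open>mset_tree T\<close> of labels. The parameters are in the order
  $\bar\lambda, \lambda, \bar\rho, \rho$.
\<close>

lift_definition G_series ::
    "nat \<Rightarrow> 'a::comm_ring_1 \<Rightarrow> 'a \<Rightarrow> 'a \<Rightarrow> 'a \<Rightarrow> 'a mseries" is
  "\<lambda>n lb l rb r m.
     \<Sum>T | T \<in> labeled_trees n \<and> mset_tree T = m.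
       lb ^ lasc T * l ^ ldes T * rb ^ rasc T * r ^ rdes T" .

lemma finite_trees_with_monomial: "finite {T. T \<in> labeled_trees n \<and> mset_tree T = m}"
proof -
  have "finite {T::nat tree. size T = k \<and> set_tree T \<subseteq> A}" if "finite A" for k A
  proof (induction k rule: less_induct)
    case (less k)
    have "{T. size T = k \<and> set_tree T \<subseteq> A} \<subseteq>
        insert Leaf ((\<lambda>(l, a, r). Node l a r) `
          ((\<Union>i<k. {T. size T = i \<and> set_tree T \<subseteq> A}) \<times> A \<times>
           (\<Union>i<k. {T. size T = i \<and> set_tree T \<subseteq> A})))" (is "_ \<subseteq> ?B")
    proof
      fix T assume "T \<in> {T. size T = k \<and> set_tree T \<subseteq> A}"
      thus "T \<in> ?B" by (cases T) (auto simp: image_iff)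
    qed
    moreover have "finite ?B" using less that by auto
    ultimately show ?case by (rule finite_subset)
  qed
  from this[of "set_mset m" n] show ?thesis
    by (rule rev_finite_subset) (auto simp: labeled_trees_def simp flip: set_mset_tree)
qed


section \<open>Roots of unity\<close>

definition primitive_root_of_unity :: "nat \<Rightarrow> complex \<Rightarrow> bool" where
  "primitive_root_of_unity k z \<longleftrightarrow> z ^ k = 1 \<and> (\<forall>j. 0 < j \<and> j < k \<longrightarrow> z ^ j \<noteq> 1)"

end

theory Submission
  imports Defs "HOL-Library.List_Lexorder"
begin

text \<open>
  Put $P = \prod_k (1 - x_k)$. Summed over $n \ge 0$, both sides give the solution
  $F = \sum_k \mathrm{Cat}_k (1 - P)^k$ of $F = 1 + (1 - P) F^2$.

  For trees this comes from the decomposition at the root, where the relations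
  $\zeta + \zeta^{-1} = \zeta \zeta^{-1} = 1$ make a product over the labels telescope.

  For regions, the coefficient of a monomial in the Frobenius characteristic counts orbits of
  coloured semiorders with that content. Sorting the elements by size of down-set, then by size
  of up-set, then by colour gives each orbit a normal form: a Dyck path with a word that has no
  descent between twins (adjacent elements with equal down-sets and up-sets). Inclusion-exclusion
  over the descents, together with the collapsing of twins in Dyck paths, expands the count in
  the coefficients of the powers $(1 - P)^k$.
\<close>

section \<open>Power series\<close>

text \<open>Why \<open>Cat_k\<close> meets \<open>(1 - P)^k\<close>: up to sign, 1 - P is the sum of
  all nonempty strictly decreasing words, a word of length b having sign (-1)^(b-1). The coefficient
  of a monomial in (1 - P)^k is therefore a signed count of words with that content cut into k
  decreasing blocks. A set S of descents of a word of length n glues its letters into n - |S| such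
  blocks, while a Dyck path with all of S among its twins collapses to one of size n - |S|. The
  passage from the Frobenius characteristic to orbits is Burnside's count: the coefficient of a
  monomial in the power sum product of a permutation is the number of colourings of that content
  fixed by it, and the character is the number of fixed regions. Two limits are avoided. The
  infinite product P is cut off at a label N that bounds the variables of the monomial under
  inspection, and division of series is replaced by cancellation of factors with constant term
  1.\<close>

lemma coeff_at_zero [simp]: "coeff_at 0 m = 0"
  by (simp add: zero_mseries.rep_eq)

lemma coeff_at_one: "coeff_at 1 m = (if m = {#} then 1 else 0)"
  by (simp add: one_mseries.rep_eq)

lemma coeff_at_add [simp]: "coeff_at (f + g) m = coeff_at f m + coeff_at g m"
  by (simp add: plus_mseries.rep_eq)

lemma coeff_at_minus [simp]: "coeff_at (- f) m = - coeff_at f m"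
  by (simp add: uminus_mseries.rep_eq)

lemma coeff_at_diff [simp]: "coeff_at (f - g) m = coeff_at f m - coeff_at g m"
  by (simp add: minus_mseries.rep_eq)

lemma coeff_at_mult: "coeff_at (f * g) m = (\<Sum>(a, b)\<in>splits m. coeff_at f a * coeff_at g b)"
  by (simp add: times_mseries.rep_eq)

lemma coeff_at_scale [simp]: "coeff_at (scale_mseries c f) m = c * coeff_at f m"
  by (simp add: scale_mseries.rep_eq)

lemma coeff_at_sum: "coeff_at (sum f A) m = (\<Sum>x\<in>A. coeff_at (f x) m)"
  by (induction A rule: infinite_finite_induct) auto

lemma coeff_at_power_sum:
  "coeff_at (power_sum k) m = (if \<exists>i\<ge>1. m = replicate_mset k i then 1 else 0)"
  by (simp add: power_sum.rep_eq)

lemma splits_empty [simp]: "splits {#} = {({#}, {#})}"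
  by (auto simp: splits_def)

lemma coeff_at_mult_empty: "coeff_at (f * g) {#} = coeff_at f {#} * coeff_at g {#}"
  by (simp add: coeff_at_mult)

lemma scale_mseries_mult: "scale_mseries c f * g = scale_mseries c (f * g)"
  by (rule mseries_eqI) (simp add: coeff_at_mult sum_distrib_left case_prod_unfold mult.assoc)

abbreviation mconst :: "'a::comm_ring_1 \<Rightarrow> 'a mseries" where
  "mconst c \<equiv> scale_mseries c 1"

lemma mconst_one [simp]: "mconst 1 = 1"
  by (rule mseries_eqI) simp

lemma mconst_mult: "mconst c * f = scale_mseries c f"
  by (simp add: scale_mseries_mult)

definition vanishes_below :: "nat \<Rightarrow> 'a::comm_ring_1 mseries \<Rightarrow> bool" where
  "vanishes_below n f \<longleftrightarrow> (\<forall>m. size m < n \<longrightarrow> coeff_at f m = 0)"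

lemma vanishes_below_mult:
  assumes "vanishes_below k f" "vanishes_below l g"
  shows "vanishes_below (k + l) (f * g)"
  unfolding vanishes_below_def
proof (intro allI impI)
  fix m :: "nat multiset"
  assume m: "size m < k + l"
  have "coeff_at f a * coeff_at g b = 0" if "(a, b) \<in> splits m" for a b
  proof -
    have "size a + size b = size m"
      using that by (auto simp: splits_def)
    then have "size a < k \<or> size b < l" using m by linarith
    then show ?thesis using assms by (auto simp: vanishes_below_def)
  qed
  then show "coeff_at (f * g) m = 0"
    by (auto simp: coeff_at_mult intro!: sum.neutral)
qed

lemma vanishes_below_power:
  assumes "coeff_at z {#} = 0"
  shows "vanishes_below k (z ^ k)"
proof (induction k)
  case (Suc k)
  have "vanishes_below 1 z"
    using assms by (simp add: vanishes_below_def)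
  from vanishes_below_mult[OF this Suc] show ?case by simp
qed (simp add: vanishes_below_def)

text \<open>Induction on the degree: in the coefficient of \<open>f * g\<close> at \<open>m\<close>,
  every term except the one with the constant term of \<open>f\<close> involves \<open>g\<close> at
  a smaller monomial.\<close>

lemma mseries_cancel:
  assumes f: "coeff_at f {#} = 1" and fg: "f * g = 0"
  shows "g = (0 :: 'a::comm_ring_1 mseries)"
proof (rule mseries_eqI)
  fix m
  show "coeff_at g m = coeff_at 0 m"
  proof (induction m rule: measure_induct_rule[of size])
    case (less m)
    have "0 = (\<Sum>(a, b)\<in>splits m. coeff_at f a * coeff_at g b)"
      by (simp flip: coeff_at_mult add: fg)
    also have "\<dots> = (\<Sum>(a, b)\<in>{({#}, m)}. coeff_at f a * coeff_at g b)"
    proof (rule sum.mono_neutral_right[OF finite_splits])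
      have "coeff_at f a * coeff_at g b = 0" if "(a, b) \<in> splits m" "(a, b) \<noteq> ({#}, m)" for a b
      proof -
        have "size b < size m"
          using that by (auto simp: splits_def nonempty_has_size)
        then show ?thesis using less by simp
      qed
      then show "\<forall>p\<in>splits m - {({#}, m)}. (case p of (a, b) \<Rightarrow> coeff_at f a * coeff_at g b) = 0"
        by auto
    qed (simp add: splits_def)
    also have "\<dots> = coeff_at g m" by (simp add: f)
    finally show ?case by simp
  qed
qed

text \<open>The difference of two solutions is annihilated by \<open>1 - z * (F + G)\<close>, whose
  constant term is 1.\<close>

lemma quadratic_unique:
  fixes F G z :: "'a::comm_ring_1 mseries"
  assumes z: "coeff_at z {#} = 0" and F: "F = 1 + z * F * F" and G: "G = 1 + z * G * G"
  shows "F = G"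
proof -
  have "(1 - z * (F + G)) * (F - G) = (F - z * F * F) - (G - z * G * G)"
    by (simp add: algebra_simps)
  also have "F - z * F * F = 1" using F by (simp add: algebra_simps)
  also have "G - z * G * G = 1" using G by (simp add: algebra_simps)
  finally have "(1 - z * (F + G)) * (F - G) = 0" by simp
  then have "F - G = 0"
    by (rule mseries_cancel[rotated]) (simp add: coeff_at_one coeff_at_mult_empty z)
  then show ?thesis by simp
qed

text \<open>By the Catalan recurrence, the sum of all \<open>c k * z ^ k\<close> solves the
  equation, and the solution is unique. The infinite sum is meaningful because \<open>z ^ k\<close>
  has no term of degree below \<open>k\<close>, so each coefficient involves only powers up to its
  degree.\<close>

lemma coeff_at_quadratic_solution:
  fixes z F :: "'a::comm_ring_1 mseries" and c :: "nat \<Rightarrow> nat"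
  assumes z: "coeff_at z {#} = 0" and F: "F = 1 + z * F * F"
    and c: "c 0 = 1" "\<And>n. c (Suc n) = (\<Sum>i\<le>n. c i * c (n - i))"
  shows "coeff_at F m = (\<Sum>k\<le>size m. of_nat (c k) * coeff_at (z ^ k) m)"
proof -
  have vz: "coeff_at (z ^ k) m = 0" if "size m < k" for k m
    using vanishes_below_power[OF z, of k] that by (simp add: vanishes_below_def)
  define G where "G = Abs_mseries (\<lambda>m. \<Sum>k\<le>size m. of_nat (c k) * coeff_at (z ^ k) m)"
  have G_raw: "coeff_at G m = (\<Sum>k\<le>size m. of_nat (c k) * coeff_at (z ^ k) m)" for m
    by (simp add: G_def Abs_mseries_inverse)
  \<comment> \<open>Any bound at or above the degree will do, as the additional powers of
    \<open>z\<close> vanish at \<open>m\<close>. This lets both factors of a product share one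
    bound.\<close>
  have G: "coeff_at G m = (\<Sum>k\<le>K. of_nat (c k) * coeff_at (z ^ k) m)" if "size m \<le> K" for m K
    unfolding G_raw using that vz by (intro sum.mono_neutral_left) auto
  have GG: "coeff_at (G * G) m = (\<Sum>s\<le>K. of_nat (c (Suc s)) * coeff_at (z ^ s) m)"
    if "size m \<le> K" for m K
  proof -
    have vz': "coeff_at (z ^ k) m = 0" if "K < k" for k
      using vz that \<open>size m \<le> K\<close> by simp
    have "coeff_at (G * G) m = (\<Sum>(a, b)\<in>splits m. (\<Sum>i\<le>K. \<Sum>j\<le>K.
        of_nat (c i) * of_nat (c j) * (coeff_at (z ^ i) a * coeff_at (z ^ j) b)))"
      unfolding coeff_at_mult
    proof (rule sum.cong[OF refl], unfold split_paired_all prod.case)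
      fix a b assume "(a, b) \<in> splits m"
      then have "size a + size b = size m" by (auto simp: splits_def)
      then have ab: "size a \<le> K" "size b \<le> K" using that by auto
      show "coeff_at G a * coeff_at G b = (\<Sum>i\<le>K. \<Sum>j\<le>K.
        of_nat (c i) * of_nat (c j) * (coeff_at (z ^ i) a * coeff_at (z ^ j) b))"
        by (simp add: G[OF ab(1)] G[OF ab(2)] sum_product mult_ac)
    qed
    also have "\<dots> = (\<Sum>i\<le>K. \<Sum>j\<le>K. \<Sum>(a, b)\<in>splits m.
        of_nat (c i) * of_nat (c j) * (coeff_at (z ^ i) a * coeff_at (z ^ j) b))"
      unfolding case_prod_unfold
      by (subst sum.swap, rule sum.cong, rule refl, rule sum.swap)
    also have "\<dots> = (\<Sum>i\<le>K. \<Sum>j\<le>K. of_nat (c i) * of_nat (c j) * coeff_at (z ^ (i + j)) m)"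
      by (simp add: power_add coeff_at_mult sum_distrib_left case_prod_unfold)
    also have "\<dots> = (\<Sum>(i, j)\<in>{..K} \<times> {..K}. of_nat (c i) * of_nat (c j) * coeff_at (z ^ (i + j)) m)"
      by (simp add: sum.cartesian_product)
    \<comment> \<open>Pairs with \<open>i + j > K\<close> contribute nothing, since
      \<open>z ^ (i + j)\<close> has no term of degree at most \<open>K\<close>.\<close>
    also have "\<dots> = (\<Sum>(i, j)\<in>{(i, j). i + j \<le> K}. of_nat (c i) * of_nat (c j) * coeff_at (z ^ (i + j)) m)"
      using vz' by (intro sum.mono_neutral_right) (auto, rule ccontr, simp add: not_le)
    also have "\<dots> = (\<Sum>s\<le>K. \<Sum>i\<le>s. of_nat (c i) * of_nat (c (s - i)) * coeff_at (z ^ (i + (s - i))) m)"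
      by (rule sum.triangle_reindex_eq[of "\<lambda>i j. of_nat (c i) * of_nat (c j) * coeff_at (z ^ (i + j)) m"])
    also have "\<dots> = (\<Sum>s\<le>K. of_nat (c (Suc s)) * coeff_at (z ^ s) m)"
      by (intro sum.cong refl) (simp add: c sum_distrib_right)
    finally show ?thesis .
  qed
  have "G = 1 + z * (G * G)"
  proof (rule mseries_eqI)
    fix m :: "nat multiset"
    define K where "K = size m"
    have "coeff_at (z * (G * G)) m
        = (\<Sum>(a, b)\<in>splits m. \<Sum>s\<le>K. of_nat (c (Suc s)) * (coeff_at z a * coeff_at (z ^ s) b))"
      unfolding coeff_at_mult[of z]
    proof (rule sum.cong[OF refl], unfold split_paired_all prod.case)
      fix a b assume "(a, b) \<in> splits m"
      then have "size b \<le> K" by (auto simp: splits_def K_def)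
      from GG[OF this] show "coeff_at z a * coeff_at (G * G) b
          = (\<Sum>s\<le>K. of_nat (c (Suc s)) * (coeff_at z a * coeff_at (z ^ s) b))"
        by (simp add: sum_distrib_left mult_ac)
    qed
    also have "\<dots> = (\<Sum>s\<le>K. of_nat (c (Suc s)) * coeff_at (z ^ Suc s) m)"
      unfolding case_prod_unfold
      by (subst sum.swap) (simp add: coeff_at_mult case_prod_unfold sum_distrib_left)
    finally have *: "coeff_at (z * (G * G)) m = (\<Sum>s\<le>K. of_nat (c (Suc s)) * coeff_at (z ^ Suc s) m)" .
    have "coeff_at G m = (\<Sum>k\<le>Suc K. of_nat (c k) * coeff_at (z ^ k) m)"
      by (rule G) (simp add: K_def)
    also have "\<dots> = coeff_at 1 m + (\<Sum>s\<le>K. of_nat (c (Suc s)) * coeff_at (z ^ Suc s) m)"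
      by (subst sum.atMost_Suc_shift) (simp add: c del: power_Suc)
    finally show "coeff_at G m = coeff_at (1 + z * (G * G)) m" by (simp add: *)
  qed
  then have "F = G"
    using quadratic_unique[OF z F, of G] by (simp add: mult.assoc)
  then show ?thesis by (simp add: G_raw)
qed

section \<open>Generating series of weighted sets\<close>

definition gen_series :: "('c \<Rightarrow> nat multiset) \<Rightarrow> 'c set \<Rightarrow> ('c \<Rightarrow> 'a::comm_ring_1) \<Rightarrow> 'a mseries" where
  "gen_series \<mu> S f = Abs_mseries (\<lambda>m. \<Sum>c | c \<in> S \<and> \<mu> c = m. f c)"

lemma coeff_at_gen_series: "coeff_at (gen_series \<mu> S f) m = (\<Sum>c | c \<in> S \<and> \<mu> c = m. f c)"
  by (simp add: gen_series_def Abs_mseries_inverse)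

text \<open>The condition under which \<open>gen_series\<close> is the expected sum of weighted
  monomials: a sum over an infinite set is 0 by convention.\<close>

definition finite_fibres :: "('c \<Rightarrow> 'd) \<Rightarrow> 'c set \<Rightarrow> bool" where
  "finite_fibres \<mu> S \<longleftrightarrow> (\<forall>m. finite {c \<in> S. \<mu> c = m})"

lemma finite_fibres_subset:
  assumes "finite_fibres \<mu> T" "S \<subseteq> T"
  shows "finite_fibres \<mu> S"
  unfolding finite_fibres_def
proof
  fix m
  show "finite {c \<in> S. \<mu> c = m}"
    by (rule finite_subset[of _ "{c \<in> T. \<mu> c = m}"]) (use assms in \<open>auto simp: finite_fibres_def\<close>)
qed

lemma finite_fibres_finite: "finite S \<Longrightarrow> finite_fibres \<mu> S"
  by (simp add: finite_fibres_def)

lemma gen_series_mult: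
  assumes "finite_fibres \<mu> S" "finite_fibres \<nu> T"
  shows "gen_series \<mu> S f * gen_series \<nu> T g
    = gen_series (\<lambda>(c, d). \<mu> c + \<nu> d) (S \<times> T) (\<lambda>(c, d). f c * g d)"
proof (rule mseries_eqI)
  fix m
  have fin: "finite {c \<in> S. \<mu> c = a}" "finite {d \<in> T. \<nu> d = b}" for a b
    using assms by (auto simp: finite_fibres_def)
  have "coeff_at (gen_series \<mu> S f * gen_series \<nu> T g) m
      = (\<Sum>p\<in>splits m. \<Sum>q\<in>{c \<in> S. \<mu> c = fst p} \<times> {d \<in> T. \<nu> d = snd p}. f (fst q) * g (snd q))"
    by (simp add: coeff_at_mult coeff_at_gen_series case_prod_unfold sum_product sum.cartesian_product)
  also have "\<dots> = (\<Sum>(p, q)\<in>(SIGMA p:splits m. {c \<in> S. \<mu> c = fst p} \<times> {d \<in> T. \<nu> d = snd p}).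
      f (fst q) * g (snd q))"
    by (subst sum.Sigma) (auto simp: fin)
  also have "\<dots> = (\<Sum>q | q \<in> S \<times> T \<and> (case q of (c, d) \<Rightarrow> \<mu> c + \<nu> d) = m. case q of (c, d) \<Rightarrow> f c * g d)"
    by (rule sum.reindex_bij_witness[where i = "\<lambda>q. ((\<mu> (fst q), \<nu> (snd q)), q)" and j = snd])
       (auto simp: splits_def)
  finally show "coeff_at (gen_series \<mu> S f * gen_series \<nu> T g) m
      = coeff_at (gen_series (\<lambda>(c, d). \<mu> c + \<nu> d) (S \<times> T) (\<lambda>(c, d). f c * g d)) m"
    by (simp add: coeff_at_gen_series)
qed

lemma finite_fibres_Times:
  fixes \<mu> :: "'c \<Rightarrow> nat multiset"
  assumes "finite_fibres \<mu> S" "finite_fibres \<nu> T"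
  shows "finite_fibres (\<lambda>(c, d). \<mu> c + \<nu> d) (S \<times> T)"
  unfolding finite_fibres_def
proof
  fix m
  have "finite (\<Union>p\<in>splits m. {c \<in> S. \<mu> c = fst p} \<times> {d \<in> T. \<nu> d = snd p})"
    using assms by (auto simp: finite_fibres_def)
  then show "finite {p \<in> S \<times> T. (case p of (c, d) \<Rightarrow> \<mu> c + \<nu> d) = m}"
    by (rule rev_finite_subset) (auto simp: splits_def)
qed

lemma gen_series_reindex:
  assumes "bij_betw h S T"
    and "\<And>c. c \<in> S \<Longrightarrow> \<nu> (h c) = \<mu> c" "\<And>c. c \<in> S \<Longrightarrow> g (h c) = f c"
  shows "gen_series \<mu> S f = gen_series \<nu> T g"
proof (rule mseries_eqI)
  fix m
  have "bij_betw h {c \<in> S. \<mu> c = m} {d \<in> T. \<nu> d = m}"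
    using assms(1,2) by (auto simp: bij_betw_def inj_on_def)
  then have "(\<Sum>c | c \<in> S \<and> \<mu> c = m. g (h c)) = (\<Sum>d | d \<in> T \<and> \<nu> d = m. g d)"
    by (rule sum.reindex_bij_betw)
  then show "coeff_at (gen_series \<mu> S f) m = coeff_at (gen_series \<nu> T g) m"
    using assms(3) by (simp add: coeff_at_gen_series)
qed

lemma gen_series_cong:
  assumes "\<And>c. c \<in> S \<Longrightarrow> f c = g c"
  shows "gen_series \<mu> S f = gen_series \<mu> S g"
  using assms by (intro mseries_eqI) (auto simp: coeff_at_gen_series intro!: sum.cong)

lemma gen_series_UNION:
  assumes "finite J" "finite_fibres \<mu> (\<Union>j\<in>J. S j)"
    and "\<And>i j. i \<in> J \<Longrightarrow> j \<in> J \<Longrightarrow> i \<noteq> j \<Longrightarrow> S i \<inter> S j = {}"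
  shows "gen_series \<mu> (\<Union>j\<in>J. S j) f = (\<Sum>j\<in>J. gen_series \<mu> (S j) f)"
proof (rule mseries_eqI)
  fix m
  have "{c. c \<in> (\<Union>j\<in>J. S j) \<and> \<mu> c = m} = (\<Union>j\<in>J. {c \<in> S j. \<mu> c = m})"
    by auto
  moreover have "finite {c \<in> S j. \<mu> c = m}" if "j \<in> J" for j
    by (rule finite_subset[of _ "{c \<in> (\<Union>j\<in>J. S j). \<mu> c = m}"])
       (use assms(2) that in \<open>auto simp: finite_fibres_def\<close>)
  moreover have "\<forall>i\<in>J. \<forall>j\<in>J. i \<noteq> j \<longrightarrow> {c \<in> S i. \<mu> c = m} \<inter> {c \<in> S j. \<mu> c = m} = {}"
    using assms(3) by blast
  ultimately show "coeff_at (gen_series \<mu> (\<Union>j\<in>J. S j) f) m = coeff_at (\<Sum>j\<in>J. gen_series \<mu> (S j) f) m"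
    using assms(1) by (simp only: coeff_at_gen_series coeff_at_sum) (rule sum.UNION_disjoint; blast)
qed

lemma gen_series_Un:
  assumes "finite_fibres \<mu> S" "finite_fibres \<mu> T" "S \<inter> T = {}"
  shows "gen_series \<mu> (S \<union> T) f = gen_series \<mu> S f + gen_series \<mu> T f"
proof (rule mseries_eqI)
  fix m
  have "{c. c \<in> S \<union> T \<and> \<mu> c = m} = {c \<in> S. \<mu> c = m} \<union> {c \<in> T. \<mu> c = m}" by auto
  then show "coeff_at (gen_series \<mu> (S \<union> T) f) m = coeff_at (gen_series \<mu> S f + gen_series \<mu> T f) m"
    using assms by (simp add: coeff_at_gen_series) (subst sum.union_disjoint; auto simp: finite_fibres_def)
qed

lemma gen_series_scale: "gen_series \<mu> S (\<lambda>x. c * f x) = mconst c * gen_series \<mu> S f"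
  by (rule mseries_eqI) (simp add: mconst_mult coeff_at_gen_series sum_distrib_left)

lemma gen_series_singleton_empty: "\<mu> c = {#} \<Longrightarrow> f c = 1 \<Longrightarrow> gen_series \<mu> {c} f = 1"
  by (rule mseries_eqI) (auto simp: coeff_at_gen_series coeff_at_one Collect_conv_if conj_commute cong: conj_cong)

text \<open>The variable x_k, presented as the series of a one-element set so that multiplication by
  it is an instance of \<open>gen_series_mult\<close>.\<close>

definition mvar :: "nat \<Rightarrow> 'a::comm_ring_1 mseries" where
  "mvar k = gen_series (\<lambda>_. {#k#}) (UNIV :: unit set) (\<lambda>_. 1)"

section \<open>The tree series\<close>

text \<open>The number of nodes is left free: all sizes are summed at once, and the degree of a
  monomial recovers the size. The bound on the labels keeps the product over the labels
  finite.\<close>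

definition trees_upto :: "nat \<Rightarrow> nat tree set" where
  "trees_upto N = {T. set_tree T \<subseteq> {1..N}}"

definition rooted_trees :: "nat \<Rightarrow> nat \<Rightarrow> nat tree set" where
  "rooted_trees N k = {T \<in> trees_upto N. \<exists>l r. T = Node l k r}"

text \<open>Both ascent parameters are 1 in the series under study, so only descents carry
  weight.\<close>

definition descent_weight :: "'a::comm_ring_1 \<Rightarrow> 'a \<Rightarrow> nat tree \<Rightarrow> 'a" where
  "descent_weight l r T = l ^ ldes T * r ^ rdes T"

definition left_edge_weight :: "'a::comm_ring_1 \<Rightarrow> nat \<Rightarrow> nat tree \<Rightarrow> 'a" where
  "left_edge_weight l w T = (case T of Leaf \<Rightarrow> 1 | Node _ v _ \<Rightarrow> if v \<le> w then 1 else l)"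

definition right_edge_weight :: "'a::comm_ring_1 \<Rightarrow> nat \<Rightarrow> nat tree \<Rightarrow> 'a" where
  "right_edge_weight r v T = (case T of Leaf \<Rightarrow> 1 | Node _ w _ \<Rightarrow> if v \<le> w then 1 else r)"

lemma descent_weight_simps:
  "descent_weight l r Leaf = 1"
  "descent_weight l r (Node A k B) =
     (left_edge_weight l k A * descent_weight l r A) * (right_edge_weight r k B * descent_weight l r B)"
  by (auto simp: descent_weight_def left_edge_weight_def right_edge_weight_def power_add
        split: tree.splits)

lemma finite_fibres_trees: "finite_fibres mset_tree (trees_upto N)"
  unfolding finite_fibres_def
proof
  fix m
  show "finite {T \<in> trees_upto N. mset_tree T = m}"
    by (rule finite_subset[OF _ finite_trees_with_monomial[of "size m" m]])
       (force simp: trees_upto_def labeled_trees_def)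
qed

text \<open>The edge above a subtree sees only the label of the subtree's root. Grouping by that
  label turns an additional edge weight \<open>e\<close> into scalars \<open>q j\<close>; the
  summand 1 comes from the empty tree.\<close>

lemma gen_series_trees_by_root:
  fixes e :: "nat tree \<Rightarrow> 'a::comm_ring_1"
  assumes e: "e Leaf = 1" "\<And>A j B. e (Node A j B) = q j"
  shows "gen_series mset_tree (trees_upto N) (\<lambda>T. e T * descent_weight l r T)
    = 1 + (\<Sum>j=1..N. mconst (q j) * gen_series mset_tree (rooted_trees N j) (descent_weight l r))"
proof -
  let ?f = "\<lambda>T. e T * descent_weight l r T"
  have sub: "(\<Union>j\<in>{1..N}. rooted_trees N j) \<subseteq> trees_upto N"
    by (auto simp: rooted_trees_def)
  have fin: "finite_fibres mset_tree (\<Union>j\<in>{1..N}. rooted_trees N j)"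
    using finite_fibres_trees sub by (rule finite_fibres_subset)
  have "trees_upto N = {Leaf} \<union> (\<Union>j\<in>{1..N}. rooted_trees N j)"
  proof (rule set_eqI)
    fix T show "T \<in> trees_upto N \<longleftrightarrow> T \<in> {Leaf} \<union> (\<Union>j\<in>{1..N}. rooted_trees N j)"
      by (cases T) (auto simp: trees_upto_def rooted_trees_def)
  qed
  then have "gen_series mset_tree (trees_upto N) ?f
      = gen_series mset_tree {Leaf} ?f + gen_series mset_tree (\<Union>j\<in>{1..N}. rooted_trees N j) ?f"
    using gen_series_Un[OF _ fin, of "{Leaf}" ?f]
    by (simp add: finite_fibres_finite rooted_trees_def)
  also have "gen_series mset_tree {Leaf} ?f = 1"
    by (rule gen_series_singleton_empty) (simp_all add: e descent_weight_simps)
  also have "gen_series mset_tree (\<Union>j\<in>{1..N}. rooted_trees N j) ?f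
      = (\<Sum>j=1..N. gen_series mset_tree (rooted_trees N j) ?f)"
    using fin by (intro gen_series_UNION) (auto simp: rooted_trees_def)
  also have "\<dots> = (\<Sum>j=1..N. gen_series mset_tree (rooted_trees N j) (\<lambda>T. q j * descent_weight l r T))"
    by (intro sum.cong refl gen_series_cong) (auto simp: rooted_trees_def e)
  finally show ?thesis by (simp add: gen_series_scale)
qed

lemma gen_series_rooted_trees:
  assumes "k \<in> {1..N}"
  shows "gen_series mset_tree (rooted_trees N k) (descent_weight l r)
    = mvar k *
      (gen_series mset_tree (trees_upto N) (\<lambda>T. left_edge_weight l k T * descent_weight l r T) *
       gen_series mset_tree (trees_upto N) (\<lambda>T. right_edge_weight r k T * descent_weight l r T))"
proof -
  let ?T = "trees_upto N"
  let ?fl = "\<lambda>T. left_edge_weight l k T * descent_weight l r T"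
  let ?fr = "\<lambda>T. right_edge_weight r k T * descent_weight l r T"
  let ?\<mu> = "\<lambda>(A, B). mset_tree A + mset_tree B" and ?f = "\<lambda>(A, B). ?fl A * ?fr B"
  have "mvar k * (gen_series mset_tree ?T ?fl * gen_series mset_tree ?T ?fr)
      = gen_series (\<lambda>(_, p). {#k#} + ?\<mu> p) ((UNIV :: unit set) \<times> (?T \<times> ?T)) (\<lambda>(_, p). 1 * ?f p)"
    unfolding mvar_def gen_series_mult[OF finite_fibres_trees finite_fibres_trees]
    by (rule gen_series_mult[OF finite_fibres_finite finite_fibres_Times[OF finite_fibres_trees finite_fibres_trees]])
       simp
  also have "\<dots> = gen_series mset_tree (rooted_trees N k) (descent_weight l r)"
  proof (rule gen_series_reindex[where h = "\<lambda>(_, A, B). Node A k B"])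
    show "bij_betw (\<lambda>(_, A, B). Node A k B) ((UNIV :: unit set) \<times> (?T \<times> ?T)) (rooted_trees N k)"
      using assms
      by (intro bij_betw_byWitness[where f' = "\<lambda>T. ((), left T, right T)"])
         (auto simp: rooted_trees_def trees_upto_def subset_iff)
  qed (auto simp: descent_weight_simps)
  finally show ?thesis by simp
qed

text \<open>With u = 1 + l B + r S' and v = 1 + B - l S, the left side is (u - r R)(v - l R) = u v -
  R (l u + r v) + R^2. Since l u + r v = 1 + R, only u v - R remains, and R = X u v.\<close>

lemma telescoping_step:
  fixes B R X S S' l r :: "'a::comm_ring_1"
  assumes lr: "l + r = 1" "l * r = 1"
    and S: "S' = S + R"
    and R: "R = X * (1 + l * B + r * S') * (1 + B - l * S)"
  shows "(1 + l * B + r * S) * (1 + B - l * S')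
    = (1 - X) * (1 + l * B + r * S') * (1 + B - l * S)"
proof -
  define u where "u = 1 + l * B + r * S'"
  define v where "v = 1 + B - l * S"
  have r2: "r = 1 - l" using lr(1) by (simp add: algebra_simps)
  have l2: "l * l = l - 1" using lr(2) by (simp add: r2 algebra_simps)
  have uv: "l * u + r * v = 1 + R"
  proof -
    have "l * u + r * v = (l + r) + (l * l + r) * B + (l * r) * (S' - S)"
      by (simp add: u_def v_def algebra_simps)
    then show ?thesis using lr S by (simp add: l2 r2)
  qed
  have "(1 + l * B + r * S) * (1 + B - l * S') = (u - r * R) * (v - l * R)"
    by (simp add: u_def v_def S algebra_simps)
  also have "\<dots> = u * v - R * (l * u + r * v) + (l * r) * R * R"
    by (simp add: algebra_simps)
  also have "\<dots> = u * v - R" by (simp add: uv lr algebra_simps)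
  also have "\<dots> = (1 - X) * u * v" using R by (simp add: u_def v_def algebra_simps)
  finally show ?thesis by (simp add: u_def v_def)
qed

text \<open>
  With $R_j$ the series of trees with root label $j$, decomposing a tree at its root gives
  $R_k = x_k u_k v_{k-1}$, where $u_k = 1 + \lambda B + \rho S_k$, $v_k = 1 + B - \lambda S_k$,
  $S_k = \sum_{j \le k} R_j$ and $B = S_N$. Because $\lambda + \rho = \lambda \rho = 1$, the
  combination $\lambda u_k + \rho v_k$ equals 1, and $u_{k-1} v_k = (1 - x_k) u_k v_{k-1}$ follows;
  the ratios telescope.
\<close>

lemma tree_series_quadratic:
  fixes l r :: "'a::comm_ring_1" and N :: nat
  assumes lr: "l + r = 1" "l * r = 1"
  defines "F \<equiv> gen_series mset_tree (trees_upto N) (descent_weight l r)"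
  shows "F = 1 + (1 - (\<Prod>k=1..N. 1 - mvar k)) * F * F"
proof -
  define R where "R k = gen_series mset_tree (rooted_trees N k) (descent_weight l r)" for k
  define S where "S k = (\<Sum>j=1..k. R j)" for k
  define B where "B = S N"
  define L where "L = mconst l"
  define D where "D = mconst r"
  have LD: "L + D = 1" "L * D = 1"
    by (rule mseries_eqI, simp add: L_def D_def lr scale_mseries_mult flip: distrib_right mult.assoc)+
  have D: "D = 1 - L" using LD(1) by (simp add: algebra_simps)
  have FB: "F = 1 + B"
    using gen_series_trees_by_root[where e = "\<lambda>_. 1" and q = "\<lambda>_. 1" and N = N and l = l and r = r]
    by (simp add: F_def B_def S_def R_def)
  have truncate: "(\<Sum>j=1..N. if j \<le> k then f j else 0) = (\<Sum>j=1..k. f j)" if "k \<le> N"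
    for k and f :: "nat \<Rightarrow> 'a mseries"
    using that by (intro sum.mono_neutral_cong_right) auto
  \<comment> \<open>The edge to a left child labelled \<open>j\<close> has weight 1 for
    \<open>j \<le> k\<close> and \<open>L\<close> otherwise. Writing 1 = L + D puts \<open>L\<close>
    on all labels and leaves \<open>D\<close> on those up to \<open>k\<close>.\<close>
  have split: "(\<Sum>j=1..N. (if j \<le> k then 1 else L) * R j) = L * B + D * S k" if "k \<le> N" for k
  proof -
    have "(\<Sum>j=1..N. (if j \<le> k then 1 else L) * R j)
        = (\<Sum>j=1..N. L * R j + (if j \<le> k then D * R j else 0))"
      by (intro sum.cong refl) (simp add: LD flip: distrib_right)
    also have "\<dots> = L * B + (\<Sum>j=1..k. D * R j)"
      by (simp only: sum.distrib truncate[OF that]) (simp add: B_def S_def sum_distrib_left)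
    finally show ?thesis by (simp add: S_def sum_distrib_left)
  qed
  \<comment> \<open>For right children the weight 1 belongs to the labels from \<open>k\<close> on.
    Writing D = 1 - L leaves a correction on the labels strictly below \<open>k\<close>, hence the
    index \<open>k - 1\<close>.\<close>
  have split': "(\<Sum>j=1..N. (if k \<le> j then 1 else D) * R j) = B - L * S (k - 1)"
    if "k \<in> {1..N}" for k
  proof -
    have "(\<Sum>j=1..N. (if k \<le> j then 1 else D) * R j)
        = (\<Sum>j=1..N. R j - (if j \<le> k - 1 then L * R j else 0))"
    proof (intro sum.cong refl)
      fix j
      show "(if k \<le> j then 1 else D) * R j = R j - (if j \<le> k - 1 then L * R j else 0)"
        using that by (auto simp: D left_diff_distrib)
    qed
    also have "\<dots> = B - (\<Sum>j=1..k - 1. L * R j)"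
      using that by (subst sum_subtractf, subst truncate) (auto simp: B_def S_def)
    finally show ?thesis by (simp add: S_def sum_distrib_left)
  qed
  define u where "u k = 1 + L * B + D * S k" for k
  define v where "v k = 1 + B - L * S k" for k
  have mif: "mconst (if b then 1 else c) = (if b then 1 else mconst c)" for b and c :: 'a
    by (auto intro!: mseries_eqI)
  have R: "R k = mvar k * (u k * v (k - 1))" if "k \<in> {1..N}" for k
  proof -
    have "gen_series mset_tree (trees_upto N) (\<lambda>T. left_edge_weight l k T * descent_weight l r T)
        = 1 + (\<Sum>j=1..N. mconst (if j \<le> k then 1 else l) * R j)"
      unfolding R_def by (rule gen_series_trees_by_root) (simp_all add: left_edge_weight_def)
    also have "\<dots> = u k"
      unfolding mif L_def[symmetric] using split[of k] that by (simp add: u_def add.assoc)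
    finally have *: "gen_series mset_tree (trees_upto N)
        (\<lambda>T. left_edge_weight l k T * descent_weight l r T) = u k" .
    have "gen_series mset_tree (trees_upto N) (\<lambda>T. right_edge_weight r k T * descent_weight l r T)
        = 1 + (\<Sum>j=1..N. mconst (if k \<le> j then 1 else r) * R j)"
      unfolding R_def by (rule gen_series_trees_by_root) (simp_all add: right_edge_weight_def)
    also have "\<dots> = v (k - 1)"
      unfolding mif D_def[symmetric] using split'[OF that] by (simp add: v_def add_diff_eq)
    finally show ?thesis
      using gen_series_rooted_trees[OF that, of l r] by (simp add: R_def *)
  qed
  have R0: "coeff_at (R k) {#} = 0" for k
    by (simp add: R_def coeff_at_gen_series rooted_trees_def) (rule sum.neutral, auto)
  have S0: "coeff_at (S k) {#} = 0" for k
    by (simp add: S_def coeff_at_sum R0)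
  have u0: "coeff_at (u k) {#} = 1" for k
    by (simp add: u_def B_def S0 coeff_at_mult_empty coeff_at_one)
  have tele: "u 0 * v j = (\<Prod>k=1..j. 1 - mvar k) * u j * v 0" if "j \<le> N" for j
    using that
  proof (induction j)
    case (Suc j)
    let ?P = "\<Prod>k=1..j. 1 - mvar k :: 'a mseries"
    let ?Q = "1 - mvar (Suc j) :: 'a mseries"
    have step: "u j * v (Suc j) = ?Q * u (Suc j) * v j"
      unfolding u_def v_def
      by (rule telescoping_step[OF LD, where R = "R (Suc j)"])
         (use Suc.prems R[of "Suc j"] in \<open>simp_all add: S_def u_def v_def mult.assoc\<close>)
    have IH: "?P * u j * v 0 = u 0 * v j" using Suc by simp
    \<comment> \<open>In place of a division by \<open>u j\<close>, the desired equation is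
      multiplied by it; the factor cancels because its constant term is 1.\<close>
    have "u j * (u 0 * v (Suc j) - ?P * ?Q * u (Suc j) * v 0)
        = u 0 * (u j * v (Suc j)) - ?Q * u (Suc j) * (?P * u j * v 0)"
      by (simp add: algebra_simps)
    also have "\<dots> = 0"
      unfolding step IH by (simp add: algebra_simps)
    finally have "u 0 * v (Suc j) - ?P * ?Q * u (Suc j) * v 0 = 0"
      by (rule mseries_cancel[OF u0])
    then show ?case by simp
  qed simp
  let ?P = "\<Prod>k=1..N. 1 - mvar k :: 'a mseries"
  have uN: "u N = F" and v0: "v 0 = F"
    using LD by (simp_all add: u_def v_def FB B_def S_def flip: distrib_right)
  have vN: "v N = 1 + D * B"
    by (simp add: v_def B_def D left_diff_distrib add_diff_eq)
  have u00: "u 0 = 1 + L * B"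
    by (simp add: u_def S_def)
  \<comment> \<open>The ends of the telescope. The left side expands to 1 + B + B^2, which is F^2 -
    F + 1 because F = 1 + B.\<close>
  have "(1 + L * B) * (1 + D * B) = ?P * F * F"
    using tele[of N] by (simp add: uN v0 vN u00)
  moreover have "(1 + L * B) * (1 + D * B) = 1 + (L + D) * B + (L * D) * (B * B)"
    by (simp add: algebra_simps)
  ultimately have "1 + B + B * B = ?P * F * F"
    by (simp add: LD)
  then show ?thesis by (simp add: FB algebra_simps)
qed

section \<open>Words\<close>

lemma finite_fibres_mset: "finite_fibres mset S"
  unfolding finite_fibres_def
proof
  fix m :: "'a multiset"
  show "finite {w \<in> S. mset w = m}"
    by (rule finite_subset[OF _ finite_lists_length_eq[OF finite_set_mset[of m], of "size m"]]) auto
qed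

abbreviation strictly_decreasing :: "nat list \<Rightarrow> bool" where
  "strictly_decreasing \<equiv> sorted_wrt (>)"

text \<open>Needed for concatenation, which is not injective: all factorizations of one word merge
  into a single coefficient.\<close>

lemma gen_series_fibre:
  assumes "h ` S \<subseteq> T" "finite_fibres \<mu> T" "finite_fibres h S"
  shows "gen_series (\<lambda>c. \<mu> (h c)) S f = gen_series \<mu> T (\<lambda>d. \<Sum>c | c \<in> S \<and> h c = d. f c)"
proof (rule mseries_eqI)
  fix m
  have "{c \<in> S. \<mu> (h c) = m} = (\<Union>d\<in>{d \<in> T. \<mu> d = m}. {c \<in> S. h c = d})"
    using assms(1) by auto
  moreover have "(\<Sum>c\<in>(\<Union>d\<in>{d \<in> T. \<mu> d = m}. {c \<in> S. h c = d}). f c)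
      = (\<Sum>d\<in>{d \<in> T. \<mu> d = m}. \<Sum>c\<in>{c \<in> S. h c = d}. f c)"
    using assms(2,3) by (intro sum.UNION_disjoint) (auto simp: finite_fibres_def)
  ultimately show "coeff_at (gen_series (\<lambda>c. \<mu> (h c)) S f) m
      = coeff_at (gen_series \<mu> T (\<lambda>d. \<Sum>c | c \<in> S \<and> h c = d. f c)) m"
    by (simp add: coeff_at_gen_series)
qed

text \<open>A strictly decreasing word is the same as the set of its letters, so this is the
  expansion of the product. In the induction, the new largest letter can only stand in front, and it
  flips the sign.\<close>

lemma decreasing_words_series:
  "gen_series mset {w \<in> lists {1..N}. strictly_decreasing w} (\<lambda>w. (-1) ^ length w)
    = (\<Prod>k=1..N. 1 - mvar k :: 'a::comm_ring_1 mseries)"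
proof (induction N)
  case 0
  have "{w \<in> lists {1..0}. strictly_decreasing w} = {[]}" by auto
  then show ?case by (simp add: gen_series_singleton_empty)
next
  case (Suc N)
  define W where "W = {w \<in> lists {1..N}. strictly_decreasing w}"
  define f :: "nat list \<Rightarrow> 'a" where "f w = (-1) ^ length w" for w
  have "{w \<in> lists {1..Suc N}. strictly_decreasing w} = W \<union> (#) (Suc N) ` W"
  proof (rule set_eqI)
    fix w show "w \<in> {w \<in> lists {1..Suc N}. strictly_decreasing w} \<longleftrightarrow> w \<in> W \<union> (#) (Suc N) ` W"
      by (cases w) (fastforce simp: W_def image_iff lists_eq_set)+
  qed
  moreover have "W \<inter> (#) (Suc N) ` W = {}"
    by (auto simp: W_def)
  ultimately have "gen_series mset {w \<in> lists {1..Suc N}. strictly_decreasing w} f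
      = gen_series mset W f + gen_series mset ((#) (Suc N) ` W) f"
    by (simp add: gen_series_Un finite_fibres_mset)
  also have "gen_series mset ((#) (Suc N) ` W) f
      = gen_series (\<lambda>(_, w). {#Suc N#} + mset w) ((UNIV :: unit set) \<times> W) (\<lambda>(_, w). 1 * (- f w))"
    by (rule gen_series_reindex[where h = "\<lambda>w. ((), tl w)"])
       (auto simp: bij_betw_def inj_on_def f_def image_iff)
  also have "\<dots> = mvar (Suc N) * gen_series mset W (\<lambda>w. - f w)"
    unfolding mvar_def by (rule gen_series_mult[symmetric]) (auto intro: finite_fibres_finite finite_fibres_mset)
  also have "gen_series mset W (\<lambda>w. - f w) = - gen_series mset W f"
    by (rule mseries_eqI) (simp add: coeff_at_gen_series sum_negf)
  also have "gen_series mset W f = (\<Prod>k=1..N. 1 - mvar k)"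
    using Suc by (simp add: W_def f_def[abs_def])
  finally show ?case by (simp add: f_def algebra_simps)
qed

text \<open>
  The signed number of factorizations of a word into \<open>k\<close> nonempty strictly decreasing blocks, a
  block of length \<open>b\<close> having sign \<open>(-1) ^ (b - 1)\<close>.
\<close>

fun block_sign_sum :: "nat list \<Rightarrow> nat \<Rightarrow> 'a::comm_ring_1" where
  "block_sign_sum [] k = (if k = 0 then 1 else 0)"
| "block_sign_sum [a] k = (if k = 1 then 1 else 0)"
| "block_sign_sum (a # b # w) k =
     (if k = 0 then 0 else block_sign_sum (b # w) (k - 1))
     - (if a > b then block_sign_sum (b # w) k else 0)"

lemma block_sign_sum_0: "block_sign_sum w 0 = (if w = [] then 1 else 0)"
  by (induction w "0 :: nat" rule: block_sign_sum.induct) auto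

lemma block_sign_sum_eq_0: "k > length w \<Longrightarrow> block_sign_sum w k = 0"
  by (induction w k rule: block_sign_sum.induct) auto

definition first_block_splits :: "nat list \<Rightarrow> (nat list \<times> nat list) set" where
  "first_block_splits w = {(u, v). u @ v = w \<and> u \<noteq> [] \<and> strictly_decreasing u}"

lemma finite_append_splits: "finite {(u, v). u @ v = (w :: 'a list)}"
proof -
  have "{(u, v). u @ v = w} \<subseteq> (\<lambda>i. (take i w, drop i w)) ` {..length w}"
  proof clarify
    fix u v :: "'a list"
    show "(u, v) \<in> (\<lambda>i. (take i (u @ v), drop i (u @ v))) ` {..length (u @ v)}"
      by (rule image_eqI[of _ _ "length u"]) auto
  qed
  then show ?thesis by (rule finite_subset) simp
qed

text \<open>The defining recursion peels off letters, this one peels off blocks. They agree because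
  the first letter either is a block by itself or, if it exceeds its successor, prolongs the first
  block of the rest, which flips the sign.\<close>

lemma block_sign_sum_first_block:
  "block_sign_sum w (Suc k)
    = (\<Sum>(u, v)\<in>first_block_splits w. (-1) ^ (length u - 1) * block_sign_sum v k)"
proof (induction w "Suc k" rule: block_sign_sum.induct)
  case 1
  have "first_block_splits [] = {}" by (auto simp: first_block_splits_def)
  then show ?case by simp
next
  case (2 a)
  have "first_block_splits [a] = {([a], [])}"
    by (auto simp: first_block_splits_def append_eq_Cons_conv)
  then show ?case by simp
next
  case (3 a b w)
  let ?f = "\<lambda>(u, v). (-1) ^ (length u - 1) * block_sign_sum v k :: 'a"
  let ?T = "if a > b then (\<lambda>(u, v). (a # u, v)) ` first_block_splits (b # w) else {}"
  have fin: "finite (first_block_splits w)" for w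
    by (rule finite_subset[OF _ finite_append_splits[of w]]) (auto simp: first_block_splits_def)
  have "first_block_splits (a # b # w) = insert ([a], b # w) ?T"
  proof (rule set_eqI, clarify)
    fix u v
    show "(u, v) \<in> first_block_splits (a # b # w) \<longleftrightarrow> (u, v) \<in> insert ([a], b # w) ?T"
      by (cases u; cases "tl u") (auto simp: first_block_splits_def image_iff)
  qed
  moreover have "([a], b # w) \<notin> ?T" by (auto simp: first_block_splits_def)
  ultimately have "sum ?f (first_block_splits (a # b # w)) = block_sign_sum (b # w) k + sum ?f ?T"
    using fin[of "b # w"] by simp
  also have "sum ?f ?T = - (if a > b then sum ?f (first_block_splits (b # w)) else 0)"
  proof (cases "a > b")
    case True
    have "sum ?f ?T = (\<Sum>p\<in>first_block_splits (b # w). - ?f p)"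
      using True
      by (subst if_P, simp, subst sum.reindex)
         (auto simp: inj_on_def first_block_splits_def neq_Nil_conv intro!: sum.cong)
    then show ?thesis using True by (simp add: sum_negf)
  qed simp
  finally show ?case using 3 by (cases "a > b") simp_all
qed

text \<open>A product of \<open>k\<close> block series runs over \<open>k\<close>-tuples of blocks;
  sorting these by their concatenation gives a sum over words.\<close>

lemma power_decreasing_words_series:
  "(1 - (\<Prod>k=1..N. 1 - mvar k :: 'a::comm_ring_1 mseries)) ^ k
    = gen_series mset (lists {1..N}) (\<lambda>w. block_sign_sum w k)"
proof (induction k)
  case 0
  have "{w. w = [] \<and> w \<in> lists {Suc 0..N}} = {[]}" by auto
  then show ?case
    by (intro mseries_eqI)
       (auto simp: coeff_at_gen_series coeff_at_one block_sign_sum_0 sum.If_cases intro!: sum.neutral)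
next
  case (Suc k)
  define D where "D = {w \<in> lists {1..N}. w \<noteq> [] \<and> strictly_decreasing w}"
  define f :: "nat list \<Rightarrow> 'a" where "f w = (-1) ^ (length w - 1)" for w
  have W: "{w \<in> lists {1..N}. strictly_decreasing w} = {[]} \<union> D" by (auto simp: D_def)
  have "(\<Prod>k=1..N. 1 - mvar k :: 'a mseries) =
      gen_series mset {[]} (\<lambda>w. (-1) ^ length w) + gen_series mset D (\<lambda>w. (-1) ^ length w)"
    unfolding decreasing_words_series[symmetric] W
    by (rule gen_series_Un) (auto simp: finite_fibres_mset D_def)
  also have "gen_series mset D (\<lambda>w. (-1) ^ length w) = gen_series mset D (\<lambda>w. - 1 * f w)"
    by (rule gen_series_cong) (auto simp: D_def f_def neq_Nil_conv)
  also have "\<dots> = - gen_series mset D f"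
    by (rule mseries_eqI) (simp add: coeff_at_gen_series sum_negf)
  finally have z: "1 - (\<Prod>k=1..N. 1 - mvar k :: 'a mseries) = gen_series mset D f"
    by (simp add: gen_series_singleton_empty)
  have "gen_series mset D f * gen_series mset (lists {1..N}) (\<lambda>w. block_sign_sum w k)
      = gen_series (\<lambda>(u, v). mset u + mset v) (D \<times> lists {1..N}) (\<lambda>(u, v). f u * block_sign_sum v k)"
    by (rule gen_series_mult) (rule finite_fibres_mset)+
  also have "\<dots> = gen_series (\<lambda>p. mset (case p of (u, v) \<Rightarrow> u @ v)) (D \<times> lists {1..N})
      (\<lambda>(u, v). f u * block_sign_sum v k)"
    by (simp add: case_prod_unfold)
  also have "\<dots> = gen_series mset (lists {1..N})
      (\<lambda>w. \<Sum>p | p \<in> D \<times> lists {1..N} \<and> (case p of (u, v) \<Rightarrow> u @ v) = w.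
        case p of (u, v) \<Rightarrow> f u * block_sign_sum v k)"
  proof (rule gen_series_fibre)
    show "finite_fibres (\<lambda>(u, v). u @ v) (D \<times> lists {1..N})"
      unfolding finite_fibres_def
    proof
      fix w show "finite {p \<in> D \<times> lists {1..N}. (case p of (u, v) \<Rightarrow> u @ v) = w}"
        by (rule finite_subset[OF _ finite_append_splits[of w]]) auto
    qed
  qed (auto simp: D_def finite_fibres_mset)
  also have "\<dots> = gen_series mset (lists {1..N}) (\<lambda>w. block_sign_sum w (Suc k))"
  proof (rule gen_series_cong)
    fix w assume "w \<in> lists {1..N}"
    then have "{p \<in> D \<times> lists {1..N}. (case p of (u, v) \<Rightarrow> u @ v) = w} = first_block_splits w"
      by (auto simp: D_def first_block_splits_def)
    then show "(\<Sum>p | p \<in> D \<times> lists {1..N} \<and> (case p of (u, v) \<Rightarrow> u @ v) = w.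
        case p of (u, v) \<Rightarrow> f u * block_sign_sum v k) = (block_sign_sum w (Suc k) :: 'a)"
      by (simp add: block_sign_sum_first_block f_def)
  qed
  finally show ?case unfolding power_Suc Suc unfolding z .
qed

section \<open>Inclusion-exclusion over sets of descents\<close>

definition descents :: "nat list \<Rightarrow> nat set" where
  "descents w = {i. Suc i < length w \<and> w ! i > w ! Suc i}"

lemma finite_descents [simp]: "finite (descents w)"
  by (rule finite_subset[of _ "{..<length w}"]) (auto simp: descents_def)

lemma descents_Cons:
  "descents (a # b # w) = Suc ` descents (b # w) \<union> (if a > b then {0} else {})"
proof (rule set_eqI)
  fix i show "i \<in> descents (a # b # w) \<longleftrightarrow> i \<in> Suc ` descents (b # w) \<union> (if a > b then {0} else {})"
    by (cases i) (auto simp: descents_def)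
qed

lemma sum_Pow_insert:
  assumes "x \<notin> A" "finite A"
  shows "(\<Sum>S\<in>Pow (insert x A). f S) = (\<Sum>S\<in>Pow A. f S) + (\<Sum>S\<in>Pow A. f (insert x S))"
proof -
  have "inj_on (insert x) (Pow A)"
    using assms(1) by (auto simp: inj_on_def)
  moreover have "Pow A \<inter> insert x ` Pow A = {}" using assms(1) by auto
  ultimately show ?thesis
    using assms(2) by (simp add: Pow_insert sum.union_disjoint sum.reindex)
qed

text \<open>A set S of descents marks the places where adjacent letters share a block; this gives
  \<open>length w - card S\<close> decreasing blocks of total sign (-1)^|S|. The weight
  \<open>c\<close> is kept general because splitting off the first letter shifts its
  argument.\<close>

lemma sum_descent_subsets:
  fixes c :: "nat \<Rightarrow> 'a::comm_ring_1"
  shows "(\<Sum>S\<in>Pow (descents w). (-1) ^ card S * c (length w - card S))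
    = (\<Sum>k\<le>length w. c k * block_sign_sum w k)"
proof (induction w arbitrary: c rule: induct_list012)
  case 1
  show ?case by (simp add: descents_def)
next
  case (2 a)
  show ?case by (simp add: descents_def)
next
  case (3 a b w)
  define D where "D = descents (b # w)"
  define n where "n = length (b # w)"
  have small: "card S < n" if "S \<in> Pow D" for S
  proof -
    have "S \<subseteq> {..<length w}" using that by (auto simp: D_def descents_def)
    then have "card S \<le> length w" by (metis card_lessThan card_mono finite_lessThan)
    then show ?thesis by (simp add: n_def)
  qed
  have cS: "card (Suc ` S) = card S" for S by (simp add: card_image)
  have c0: "card (insert 0 (Suc ` S)) = Suc (card S)" if "S \<in> Pow D" for S
    using that finite_subset[of S D] by (subst card_insert_disjoint) (auto simp: D_def cS)
  \<comment> \<open>Sets without 0: the first letter is a block of its own, so there is one block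
    more and \<open>c\<close> is shifted.\<close>
  have A: "(\<Sum>S\<in>Pow (Suc ` D). (-1) ^ card S * c (Suc n - card S))
      = (\<Sum>k\<le>n. c (Suc k) * block_sign_sum (b # w) k)"
  proof -
    have "(\<Sum>S\<in>Pow (Suc ` D). (-1) ^ card S * c (Suc n - card S))
        = (\<Sum>S\<in>Pow D. (-1) ^ card S * c (Suc (n - card S)))"
      unfolding image_Pow_surj[OF refl, symmetric]
      using small by (subst sum.reindex) (auto simp: inj_on_def inj_image_eq_iff cS Suc_diff_le less_imp_le intro!: sum.cong)
    then show ?thesis using 3(2)[of "\<lambda>k. c (Suc k)"] by (simp add: D_def n_def)
  qed
  \<comment> \<open>Sets with 0: the first letter joins the next block, so the number of blocks
    stays and the sign changes.\<close>
  have B: "(\<Sum>S\<in>Pow (Suc ` D). (-1) ^ card (insert 0 S) * c (Suc n - card (insert 0 S)))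
      = - (\<Sum>k\<le>n. c k * block_sign_sum (b # w) k)"
  proof -
    have "(\<Sum>S\<in>Pow (Suc ` D). (-1) ^ card (insert 0 S) * c (Suc n - card (insert 0 S)))
        = (\<Sum>S\<in>Pow D. - ((-1) ^ card S * c (n - card S)))"
      unfolding image_Pow_surj[OF refl, symmetric]
      by (subst sum.reindex) (auto simp: inj_on_def inj_image_eq_iff c0 intro!: sum.cong)
    then show ?thesis using 3(2)[of c] by (simp add: D_def n_def sum_negf)
  qed
  have "(\<Sum>k\<le>Suc n. c k * block_sign_sum (a # b # w) k)
      = (\<Sum>k\<le>n. c (Suc k) * block_sign_sum (b # w) k)
        - (if a > b then \<Sum>k\<le>Suc n. c k * block_sign_sum (b # w) k else 0)"
    by (subst sum.atMost_Suc_shift)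
       (auto simp: right_diff_distrib sum_subtractf sum.atMost_Suc_shift[of _ n] simp del: sum.atMost_Suc)
  also have "(\<Sum>k\<le>Suc n. c k * block_sign_sum (b # w) k) = (\<Sum>k\<le>n. c k * block_sign_sum (b # w) k)"
    by (simp add: block_sign_sum_eq_0 n_def)
  finally have rhs: "(\<Sum>k\<le>Suc n. c k * block_sign_sum (a # b # w) k)
      = (\<Sum>k\<le>n. c (Suc k) * block_sign_sum (b # w) k)
        - (if a > b then \<Sum>k\<le>n. c k * block_sign_sum (b # w) k else 0)" .
  have "(\<Sum>S\<in>Pow (descents (a # b # w)). (-1) ^ card S * c (Suc n - card S))
      = (\<Sum>k\<le>Suc n. c k * block_sign_sum (a # b # w) k)"
  proof (cases "a > b")
    case True
    then have "descents (a # b # w) = insert 0 (Suc ` D)" by (simp add: descents_Cons D_def)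
    then show ?thesis
      using True by (subst rhs) (simp add: sum_Pow_insert D_def A[unfolded D_def] B[unfolded D_def])
  next
    case False
    then show ?thesis by (subst rhs) (simp add: descents_Cons A[unfolded D_def])
  qed
  then show ?case by (simp add: n_def)
qed

section \<open>Dyck paths and twins\<close>

text \<open>
  A Dyck path is encoded by the sizes of the down-sets: \<open>d ! j\<close> is the number of \<open>i\<close> below \<open>j\<close> in
  the semiorder on \<open>{..<n}\<close> in which \<open>i\<close> is below \<open>j\<close> iff \<open>i < d ! j\<close>. The up-sets of \<open>j\<close> and
  \<open>Suc j\<close> agree iff \<open>Suc j\<close> is not a value of \<open>d\<close>.
\<close>

definition down_lists :: "nat \<Rightarrow> nat list set" where
  "down_lists n = {d. length d = n \<and> sorted d \<and> (\<forall>j<n. d ! j \<le> j)}"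

definition twins :: "nat list \<Rightarrow> nat set" where
  "twins d = {j. Suc j < length d \<and> d ! j = d ! Suc j \<and> Suc j \<notin> set d}"

lemma finite_down_lists [simp]: "finite (down_lists n)"
proof (rule finite_subset)
  show "down_lists n \<subseteq> {d. set d \<subseteq> {..n} \<and> length d = n}"
    by (force simp: down_lists_def in_set_conv_nth)
qed (simp add: finite_lists_length_eq)

lemma down_lists_le_length:
  assumes "d \<in> down_lists n" "x \<in> set d"
  shows "x < n"
  using assms by (force simp: down_lists_def in_set_conv_nth)

lemma down_lists_0: "down_lists 0 = {[]}"
  by (auto simp: down_lists_def)

lemma card_down_lists_0: "card (down_lists 0) = 1"
  by (simp add: down_lists_0)

text \<open>Splits a Dyck path at its first return to the diagonal.\<close>

lemma card_down_lists_Suc: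
  "card (down_lists (Suc n)) = (\<Sum>i\<le>n. card (down_lists i) * card (down_lists (n - i)))"
proof -
  define P where "P = (SIGMA i:{..n}. down_lists i \<times> down_lists (n - i))"
  define g :: "nat \<times> nat list \<times> nat list \<Rightarrow> nat list"
    where "g = (\<lambda>(i, d1, d2). 0 # d1 @ map ((+) (Suc i)) d2)"
  have "inj_on g P"
  proof (rule inj_onI)
    fix p q assume p: "p \<in> P" and q: "q \<in> P" and eq: "g p = g q"
    obtain i d1 d2 where p': "p = (i, d1, d2)" by (cases p) auto
    obtain k e1 e2 where q': "q = (k, e1, e2)" by (cases q) auto
    \<comment> \<open>The lists differ at position \<open>i\<close>: the one with the earlier return
      has an entry of at least \<open>Suc i\<close> there, the other one an entry of at most
      \<open>i\<close>.\<close>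
    have no: False
      if "i < k" "k \<le> n" "d1 @ map ((+) (Suc i)) d2 = e1 @ map ((+) (Suc k)) e2"
        "d1 \<in> down_lists i" "d2 \<in> down_lists (n - i)" "e1 \<in> down_lists k"
      for i k d1 d2 e1 e2
    proof -
      have "(d1 @ map ((+) (Suc i)) d2) ! i = Suc i + d2 ! 0"
        using that(1,2,4,5) by (auto simp: down_lists_def nth_append)
      moreover have "(e1 @ map ((+) (Suc k)) e2) ! i = e1 ! i"
        using that(1,6) by (auto simp: down_lists_def nth_append)
      moreover have "e1 ! i \<le> i" using that(1,6) by (auto simp: down_lists_def)
      ultimately show False using that(3) by simp
    qed
    have eq': "d1 @ map ((+) (Suc i)) d2 = e1 @ map ((+) (Suc k)) e2"
      using eq by (simp add: g_def p' q')
    have "i = k"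
      using no[OF _ _ eq'] no[OF _ _ eq'[symmetric]] p q p' q'
      by (cases i k rule: linorder_cases) (auto simp: P_def)
    moreover have "length d1 = i" "length e1 = k"
      using p q p' q' by (auto simp: P_def down_lists_def)
    ultimately show "p = q" using eq' by (simp add: p' q' inj_map_eq_map)
  qed
  moreover have "g ` P = down_lists (Suc n)"
  proof (intro equalityI subsetI)
    fix d assume "d \<in> g ` P"
    then obtain i d1 d2 where d: "d = 0 # d1 @ map ((+) (Suc i)) d2" and i: "i \<le> n"
      and d1: "d1 \<in> down_lists i" and d2: "d2 \<in> down_lists (n - i)"
      by (auto simp: P_def g_def)
    have "sorted d"
      using d1 d2 down_lists_le_length[OF d1]
      by (fastforce simp: d sorted_append down_lists_def sorted_map intro: sorted_wrt_mono_rel[of _ "(\<le>)"])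
    moreover have "length d = Suc n"
      using d1 d2 i by (simp add: d down_lists_def)
    moreover have "d ! j \<le> j" if "j < Suc n" for j
    proof (cases j)
      case (Suc j')
      show ?thesis
      proof (cases "j' < i")
        case True
        then show ?thesis using d1 Suc by (auto simp: d down_lists_def nth_append intro: le_SucI)
      next
        case False
        then have "d2 ! (j' - i) \<le> j' - i"
          using d2 that Suc by (auto simp: down_lists_def)
        then have "i + d2 ! (j' - i) \<le> j'" using False by simp
        moreover have "length d1 = i" "length d2 = n - i" using d1 d2 by (auto simp: down_lists_def)
        ultimately show ?thesis using Suc False that by (simp add: d nth_append)
      qed
    qed (simp add: d)
    ultimately show "d \<in> down_lists (Suc n)" by (simp add: down_lists_def)
  next
    fix d assume d: "d \<in> down_lists (Suc n)"
    then have len: "length d = Suc n" and srt: "sorted d" and bnd: "\<And>j. j \<le> n \<Longrightarrow> d ! j \<le> j"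
      by (auto simp: down_lists_def)
    \<comment> \<open>The place of the first return. The end \<open>Suc n\<close> of the path counts
      as a return, so that a least element exists.\<close>
    define k where "k = (LEAST k. k \<ge> 1 \<and> (k = Suc n \<or> d ! k = k))"
    have k: "k \<ge> 1 \<and> (k = Suc n \<or> d ! k = k)"
      unfolding k_def by (rule LeastI[of _ "Suc n"]) simp
    have kn: "k \<le> Suc n"
      unfolding k_def by (rule Least_le) simp
    have kmin: "d ! j \<noteq> j" if "1 \<le> j" "j < k" for j
      using not_less_Least[of j "\<lambda>k. k \<ge> 1 \<and> (k = Suc n \<or> d ! k = k)"] that by (auto simp: k_def)
    define i where "i = k - 1"
    have ki: "k = Suc i" using k by (simp add: i_def)
    define d1 where "d1 = take i (tl d)"
    define d2 where "d2 = map (\<lambda>x. x - k) (drop k d)"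
    have ge: "k \<le> x" if x: "x \<in> set (drop k d)" for x
    proof -
      obtain j where j: "j < Suc n - k" "x = d ! (k + j)"
        using x len kn by (auto simp: in_set_conv_nth)
      then have "d ! k \<le> d ! (k + j)"
        using srt len by (intro sorted_nth_mono) auto
      then show ?thesis using j k by auto
    qed
    have "d1 \<in> down_lists i"
    proof -
      \<comment> \<open>Before the first return the bound \<open>d ! Suc j \<le> Suc j\<close> is
        strict, which compensates for the shift caused by dropping the leading 0.\<close>
      have "d1 ! j \<le> j" if "j < i" for j
      proof -
        have "d1 ! j = d ! Suc j" using that len by (cases d) (simp_all add: d1_def)
        moreover have "d ! Suc j \<noteq> Suc j" using that by (intro kmin) (auto simp: ki)
        moreover have "d ! Suc j \<le> Suc j" using that kn by (intro bnd) (auto simp: ki)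
        ultimately show ?thesis by simp
      qed
      moreover have "sorted d1" using srt by (simp add: d1_def sorted_tl sorted_wrt_take)
      ultimately show ?thesis using len kn by (auto simp: down_lists_def d1_def ki)
    qed
    moreover have "d2 \<in> down_lists (n - i)"
    proof -
      have "d2 ! j \<le> j" if "j < n - i" for j
      proof -
        have "d ! (k + j) \<le> k + j" using that by (intro bnd) (simp add: ki)
        then show ?thesis using that len by (simp add: d2_def ki)
      qed
      moreover have "sorted d2"
        unfolding sorted_iff_nth_mono_less
        using srt by (auto simp: d2_def intro!: diff_le_mono sorted_nth_mono)
      ultimately show ?thesis using len by (auto simp: down_lists_def d2_def ki)
    qed
    moreover have "d = 0 # d1 @ map ((+) (Suc i)) d2"
    proof -
      have "map ((+) (Suc i)) d2 = drop k d"
        unfolding d2_def ki[symmetric] by (auto intro!: map_idI dest!: ge)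
      moreover have "d ! 0 = 0" using bnd[of 0] by simp
      then obtain t where t: "d = 0 # t" using len by (cases d) auto
      ultimately show ?thesis by (simp add: d1_def ki)
    qed
    ultimately show "d \<in> g ` P"
      using kn by (intro image_eqI[of _ _ "(i, d1, d2)"]) (auto simp: P_def g_def ki)
  qed
  ultimately have "card (down_lists (Suc n)) = card P"
    by (metis card_image)
  then show ?thesis by (simp add: P_def card_cartesian_product)
qed

text \<open>Twins \<open>b\<close> and \<open>Suc b\<close> are interchangeable, so
  \<open>Suc b\<close> can be deleted and restored by doubling \<open>b\<close>. Both operations
  affect only positions and values beyond \<open>b\<close>; the twins in \<open>A\<close> survive
  because they are smaller than \<open>b\<close>.\<close>

lemma card_down_lists_collapse:
  assumes b: "Suc b < n" and A: "\<forall>a\<in>A. a < b"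
  shows "card {d \<in> down_lists n. insert b A \<subseteq> twins d} = card {d \<in> down_lists (n - 1). A \<subseteq> twins d}"
proof -
  \<comment> \<open>A value above \<open>Suc b\<close> counts the deleted element and drops by one.
    The value \<open>Suc b\<close> itself does not occur when \<open>b\<close> is a twin.\<close>
  define del :: "nat list \<Rightarrow> nat list"
    where "del d = map (\<lambda>v. if v \<le> b then v else v - 1) (take (Suc b) d @ drop (Suc (Suc b)) d)" for d
  \<comment> \<open>Values above \<open>b\<close> grow by one, so \<open>Suc b\<close> is never a
    value and the two copies of \<open>b\<close> have the same up-set.\<close>
  define dup :: "nat list \<Rightarrow> nat list"
    where "dup d = map (\<lambda>v. if v \<le> b then v else Suc v) (take (Suc b) d @ drop b d)" for d
  have len_del: "length (del d) = n - 1" if "length d = n" for d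
    using that b by (simp add: del_def)
  have len_dup: "length (dup d) = n" if "length d = n - 1" for d
    using that b by (simp add: dup_def)
  have nth_del: "del d ! j = (let v = d ! (if j \<le> b then j else Suc j) in if v \<le> b then v else v - 1)"
    if "length d = n" "j < n - 1" for d j
    using that b by (auto simp: del_def nth_append min_def)
  have nth_dup: "dup d ! j = (let v = d ! (if j \<le> b then j else j - 1) in if v \<le> b then v else Suc v)"
    if "length d = n - 1" "j < n" for d j
    using that b by (auto simp: dup_def nth_append min_absorb2)
  have set_del: "\<exists>v\<in>set d. x = (if v \<le> b then v else v - 1)" if "x \<in> set (del d)" for d x
    using that by (auto simp: del_def dest: in_set_takeD in_set_dropD)
  have set_dup: "\<exists>v\<in>set d. x = (if v \<le> b then v else Suc v)" if "x \<in> set (dup d)" for d x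
    using that by (auto simp: dup_def dest: in_set_takeD in_set_dropD)
  have "bij_betw del {d \<in> down_lists n. insert b A \<subseteq> twins d} {d \<in> down_lists (n - 1). A \<subseteq> twins d}"
  proof (rule bij_betw_byWitness[where f' = dup])
    show "\<forall>d\<in>{d \<in> down_lists n. insert b A \<subseteq> twins d}. dup (del d) = d"
    proof
      fix d assume "d \<in> {d \<in> down_lists n. insert b A \<subseteq> twins d}"
      then have d: "length d = n" "d ! b = d ! Suc b" "Suc b \<notin> set d"
        by (auto simp: down_lists_def twins_def)
      show "dup (del d) = d"
      proof (rule nth_equalityI)
        show "length (dup (del d)) = length d"
          using d by (simp add: len_del len_dup)
        fix j assume "j < length (dup (del d))"
        then have j: "j < n" using d by (simp add: len_del len_dup)
        then have "d ! j \<noteq> Suc b" using d by (auto simp: in_set_conv_nth)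
        moreover have "d ! (if j \<le> b then j else Suc (j - 1)) = d ! j" by auto
        ultimately show "dup (del d) ! j = d ! j"
          using j d b by (cases "j = Suc b") (auto simp: nth_dup nth_del len_del Let_def)
      qed
    qed
    show "\<forall>d\<in>{d \<in> down_lists (n - 1). A \<subseteq> twins d}. del (dup d) = d"
    proof
      fix d assume "d \<in> {d \<in> down_lists (n - 1). A \<subseteq> twins d}"
      then have d: "length d = n - 1" by (auto simp: down_lists_def)
      show "del (dup d) = d"
      proof (rule nth_equalityI)
        show "length (del (dup d)) = length d"
          using d by (simp add: len_del len_dup)
        fix j assume "j < length (del (dup d))"
        then have j: "j < n - 1" using d by (simp add: len_del len_dup)
        then show "del (dup d) ! j = d ! j"
          using d by (auto simp: nth_dup nth_del len_dup Let_def)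
      qed
    qed
    show "del ` {d \<in> down_lists n. insert b A \<subseteq> twins d} \<subseteq> {d \<in> down_lists (n - 1). A \<subseteq> twins d}"
    proof clarify
      fix d assume d: "d \<in> down_lists n" and tw: "insert b A \<subseteq> twins d"
      have len: "length d = n" and srt: "sorted d" and bnd: "\<And>j. j < n \<Longrightarrow> d ! j \<le> j"
        using d by (auto simp: down_lists_def)
      have mono: "d ! i \<le> d ! j" if "i \<le> j" "j < n" for i j
        using srt that len by (auto intro: sorted_nth_mono)
      have "sorted (del d)"
        unfolding sorted_iff_nth_mono_less
      proof (intro allI impI)
        fix i j assume ij: "i < j" "j < length (del d)"
        then have "d ! (if i \<le> b then i else Suc i) \<le> d ! (if j \<le> b then j else Suc j)"
          using len by (intro mono) (auto simp: len_del)
        moreover have "i < n - 1" "j < n - 1" using ij len by (auto simp: len_del)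
        ultimately show "del d ! i \<le> del d ! j"
          unfolding nth_del[OF len \<open>i < n - 1\<close>] nth_del[OF len \<open>j < n - 1\<close>] Let_def by auto
      qed
      moreover have "del d ! j \<le> j" if "j < n - 1" for j
      proof -
        have "d ! j \<le> j" "d ! Suc j \<le> Suc j" using that by (auto intro: bnd)
        then show ?thesis using that len by (auto simp: nth_del Let_def)
      qed
      ultimately have "del d \<in> down_lists (n - 1)"
        using len by (simp add: down_lists_def len_del)
      moreover have "A \<subseteq> twins (del d)"
      proof
        fix a assume a: "a \<in> A"
        then have "a \<in> twins d" "b \<in> twins d" "a < b" using tw A by auto
        then have "Suc a \<notin> set d" "Suc b \<notin> set d" "d ! a = d ! Suc a"
          by (auto simp: twins_def)
        moreover have "Suc a \<notin> set (del d)"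
        proof
          \<comment> \<open>This value could only come from \<open>Suc a\<close> itself or, if
            \<open>Suc a = b\<close>, from the lowered value \<open>Suc b\<close>; neither occurs in
            \<open>d\<close>.\<close>
          assume "Suc a \<in> set (del d)"
          then obtain v where "v \<in> set d" "Suc a = (if v \<le> b then v else v - 1)"
            using set_del by blast
          with \<open>a < b\<close> have "v = Suc a \<or> v = Suc b" by (auto split: if_splits)
          then show False using \<open>v \<in> set d\<close> \<open>Suc a \<notin> set d\<close> \<open>Suc b \<notin> set d\<close> by auto
        qed
        ultimately show "a \<in> twins (del d)"
          using \<open>a < b\<close> b len by (simp add: twins_def len_del nth_del Let_def)
      qed
      ultimately show "del d \<in> down_lists (n - 1) \<and> A \<subseteq> twins (del d)" ..
    qed
    show "dup ` {d \<in> down_lists (n - 1). A \<subseteq> twins d} \<subseteq> {d \<in> down_lists n. insert b A \<subseteq> twins d}"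
    proof clarify
      fix d assume d: "d \<in> down_lists (n - 1)" and tw: "A \<subseteq> twins d"
      have len: "length d = n - 1" and srt: "sorted d" and bnd: "\<And>j. j < n - 1 \<Longrightarrow> d ! j \<le> j"
        using d by (auto simp: down_lists_def)
      have mono: "d ! i \<le> d ! j" if "i \<le> j" "j < n - 1" for i j
        using srt that len by (auto intro: sorted_nth_mono)
      have "sorted (dup d)"
        unfolding sorted_iff_nth_mono_less
      proof (intro allI impI)
        fix i j assume ij: "i < j" "j < length (dup d)"
        then have "d ! (if i \<le> b then i else i - 1) \<le> d ! (if j \<le> b then j else j - 1)"
          using len b by (intro mono) (auto simp: len_dup)
        moreover have "i < n" "j < n" using ij len by (auto simp: len_dup)
        ultimately show "dup d ! i \<le> dup d ! j"
          unfolding nth_dup[OF len \<open>i < n\<close>] nth_dup[OF len \<open>j < n\<close>] Let_def by auto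
      qed
      moreover have "dup d ! j \<le> j" if "j < n" for j
      proof (cases "j \<le> b")
        case True
        then have "d ! j \<le> j" using b by (intro bnd) auto
        then show ?thesis using True that len by (simp add: nth_dup Let_def)
      next
        case False
        then have "d ! (j - 1) \<le> j - 1" using that by (intro bnd) auto
        then show ?thesis using False that len by (auto simp: nth_dup Let_def)
      qed
      ultimately have "dup d \<in> down_lists n"
        using len by (simp add: down_lists_def len_dup)
      moreover have "insert b A \<subseteq> twins (dup d)"
      proof
        fix a assume "a \<in> insert b A"
        then consider "a = b" | "a \<in> A" "a < b" using A by auto
        then show "a \<in> twins (dup d)"
        proof cases
          case 1
          have "Suc b \<notin> set (dup d)" using set_dup[of "Suc b" d] by (auto split: if_splits)
          then show ?thesis using 1 b len by (simp add: twins_def len_dup nth_dup Let_def)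
        next
          case 2
          then have "a \<in> twins d" using tw by auto
          moreover have "Suc a \<in> set d" if "Suc a \<in> set (dup d)"
            using set_dup[OF that] \<open>a < b\<close> by (auto split: if_splits)
          ultimately show ?thesis using \<open>a < b\<close> b len by (auto simp: twins_def len_dup nth_dup Let_def)
        qed
      qed
      ultimately show "dup d \<in> down_lists n \<and> insert b A \<subseteq> twins (dup d)" ..
    qed
  qed
  then show ?thesis by (rule bij_betw_same_card)
qed

text \<open>The induction adds elements in increasing order, so each step collapses the largest twin
  and leaves the positions of the others alone.\<close>

lemma card_down_lists_twins:
  assumes "finite S" "\<forall>j\<in>S. Suc j < n"
  shows "card {d \<in> down_lists n. S \<subseteq> twins d} = card (down_lists (n - card S))"
  using assms
proof (induction S arbitrary: n rule: finite_linorder_max_induct)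
  case (insert b A)
  have "card {d \<in> down_lists n. insert b A \<subseteq> twins d} = card {d \<in> down_lists (n - 1). A \<subseteq> twins d}"
    using insert.hyps insert.prems by (intro card_down_lists_collapse) auto
  also have "\<dots> = card (down_lists (n - 1 - card A))"
    using insert.hyps insert.prems by (intro insert.IH) force
  finally show ?case using insert.hyps by (auto simp: card_insert_if)
qed simp

lemma sum_Pow_sign:
  assumes "finite A"
  shows "(\<Sum>S\<in>Pow A. (-1) ^ card S) = (if A = {} then 1 else 0 :: 'a::comm_ring_1)"
proof (cases "A = {}")
  case False
  then obtain x B where "A = insert x B" "x \<notin> B" by (metis Set.set_insert all_not_in_conv)
  moreover have "card (insert x S) = Suc (card S)" if "S \<in> Pow B" for S
    using that calculation assms by (subst card_insert_disjoint) (auto intro: finite_subset)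
  ultimately show ?thesis using assms by (simp add: sum_Pow_insert sum_negf)
qed simp

text \<open>Inclusion-exclusion over the set S of positions in \<open>D\<close> required to be
  twins. The number of paths with these twins depends only on the size of S.\<close>

lemma card_down_lists_avoiding_twins:
  assumes "finite D" "\<forall>j\<in>D. Suc j < n"
  shows "of_nat (card {d \<in> down_lists n. twins d \<inter> D = {}})
    = (\<Sum>S\<in>Pow D. (-1) ^ card S * (of_nat (card (down_lists (n - card S))) :: 'a::comm_ring_1))"
proof -
  have "(\<Sum>S\<in>Pow D. (-1) ^ card S * (of_nat (card (down_lists (n - card S))) :: 'a))
      = (\<Sum>S\<in>Pow D. \<Sum>d\<in>down_lists n. if S \<subseteq> twins d then (-1) ^ card S else 0)"
  proof (intro sum.cong refl)
    fix S assume "S \<in> Pow D"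
    then have "card {d \<in> down_lists n. S \<subseteq> twins d} = card (down_lists (n - card S))"
      using assms by (intro card_down_lists_twins) (auto intro: finite_subset)
    then show "(-1) ^ card S * (of_nat (card (down_lists (n - card S))) :: 'a)
        = (\<Sum>d\<in>down_lists n. if S \<subseteq> twins d then (-1) ^ card S else 0)"
      by (simp add: sum.If_cases Int_def mult.commute)
  qed
  also have "\<dots> = (\<Sum>d\<in>down_lists n. \<Sum>S\<in>Pow D. if S \<subseteq> twins d then (-1) ^ card S else 0)"
    by (rule sum.swap)
  also have "\<dots> = (\<Sum>d\<in>down_lists n. if twins d \<inter> D = {} then 1 else 0)"
  proof (intro sum.cong refl)
    fix d
    have "(\<Sum>S\<in>Pow D. if S \<subseteq> twins d then (-1) ^ card S else (0 :: 'a))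
        = (\<Sum>S\<in>Pow (twins d \<inter> D). (-1) ^ card S)"
      using assms(1) by (intro sum.mono_neutral_cong_right) auto
    also have "\<dots> = (if twins d \<inter> D = {} then 1 else 0)"
      by (rule sum_Pow_sign) (simp add: assms(1))
    finally show "(\<Sum>S\<in>Pow D. if S \<subseteq> twins d then (-1) ^ card S else (0 :: 'a))
        = (if twins d \<inter> D = {} then 1 else 0)" .
  qed
  also have "\<dots> = of_nat (card {d \<in> down_lists n. twins d \<inter> D = {}})"
    by (simp add: sum.If_cases Int_def)
  finally show ?thesis by simp
qed

text \<open>The normal forms of coloured semiorders: \<open>w\<close> lists the colours in sorted
  order, and along a run of twins, which are interchangeable, they have to increase weakly.\<close>

definition normal_pairs :: "nat \<Rightarrow> (nat list \<times> nat list) set" where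
  "normal_pairs n = {(d, w). d \<in> down_lists n \<and> length w = n \<and> twins d \<inter> descents w = {}}"

lemma coeff_at_G_series:
  fixes l r :: "'a::comm_ring_1"
  assumes lr: "l + r = 1" "l * r = 1" and m: "0 \<notin># m"
  shows "coeff_at (G_series (size m) 1 l 1 r) m = of_nat (card {(d, w) \<in> normal_pairs (size m). mset w = m})"
proof -
  define n where "n = size m"
  \<comment> \<open>Inserting 0 makes the maximum well defined for the empty monomial.\<close>
  define N where "N = Max (insert 0 (set_mset m))"
  have N: "set_mset m \<subseteq> {1..N}"
    using m by (auto simp: N_def Suc_le_eq intro!: Max_ge gr0I)
  define F :: "'a mseries" where "F = gen_series mset_tree (trees_upto N) (descent_weight l r)"
  define z :: "'a mseries" where "z = 1 - (\<Prod>k=1..N. 1 - mvar k)"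
  define c where "c k = card (down_lists k)" for k
  define W where "W = {w. mset w = m}"
  have "finite W"
    using finite_fibres_mset[of "UNIV :: nat list set"] by (simp add: W_def finite_fibres_def)
  have W: "w \<in> lists {1..N}" "length w = n" if "w \<in> W" for w
    using that N by (auto simp: W_def n_def)
  have "coeff_at (G_series (size m) 1 l 1 r) m = coeff_at F m"
  proof -
    have "{T. T \<in> labeled_trees (size m) \<and> mset_tree T = m} = {T \<in> trees_upto N. mset_tree T = m}"
      using N by (force simp: labeled_trees_def trees_upto_def)
    then show ?thesis
      by (simp add: G_series.rep_eq F_def coeff_at_gen_series descent_weight_def)
  qed
  also have "\<dots> = (\<Sum>k\<le>n. of_nat (c k) * coeff_at (z ^ k) m)"
    unfolding n_def
  proof (rule coeff_at_quadratic_solution)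
    show "coeff_at z {#} = 0"
    proof -
      have "coeff_at (\<Prod>k=1..N. 1 - mvar k :: 'a mseries) {#} = 1"
        by (induction N) (auto simp: coeff_at_mult_empty coeff_at_one mvar_def coeff_at_gen_series)
      then show ?thesis by (simp add: z_def coeff_at_one)
    qed
    show "F = 1 + z * F * F"
      unfolding F_def z_def by (rule tree_series_quadratic[OF lr])
  qed (simp_all add: c_def card_down_lists_0 card_down_lists_Suc)
  also have "\<dots> = (\<Sum>k\<le>n. of_nat (c k) * (\<Sum>w\<in>W. block_sign_sum w k))"
  proof (intro sum.cong refl)
    fix k
    have "{w. w \<in> lists {1..N} \<and> mset w = m} = W" using W by (auto simp: W_def)
    then show "of_nat (c k) * coeff_at (z ^ k) m = of_nat (c k) * (\<Sum>w\<in>W. block_sign_sum w k)"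
      unfolding z_def power_decreasing_words_series coeff_at_gen_series by simp
  qed
  also have "\<dots> = (\<Sum>w\<in>W. \<Sum>k\<le>n. of_nat (c k) * block_sign_sum w k)"
    unfolding sum_distrib_left by (rule sum.swap)
  \<comment> \<open>For each word, the sum of signed block counts weighted by Catalan numbers is an
    inclusion-exclusion sum over its descents, so it counts the paths without a twin at a
    descent.\<close>
  also have "\<dots> = (\<Sum>w\<in>W. of_nat (card {d \<in> down_lists n. twins d \<inter> descents w = {}}))"
  proof (intro sum.cong refl)
    fix w assume "w \<in> W"
    have "(\<Sum>k\<le>n. of_nat (c k) * block_sign_sum w k)
        = (\<Sum>S\<in>Pow (descents w). (-1) ^ card S * (of_nat (c (n - card S)) :: 'a))"
      using sum_descent_subsets[where w = w and c = "\<lambda>k. of_nat (c k) :: 'a"] W[OF \<open>w \<in> W\<close>] by simp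
    also have "\<dots> = of_nat (card {d \<in> down_lists n. twins d \<inter> descents w = {}})"
      unfolding c_def using W[OF \<open>w \<in> W\<close>]
      by (intro card_down_lists_avoiding_twins[symmetric] finite_descents) (auto simp: descents_def)
    finally show "(\<Sum>k\<le>n. of_nat (c k) * block_sign_sum w k)
        = (of_nat (card {d \<in> down_lists n. twins d \<inter> descents w = {}}) :: 'a)" .
  qed
  also have "\<dots> = of_nat (card (SIGMA w:W. {d \<in> down_lists n. twins d \<inter> descents w = {}}))"
    using \<open>finite W\<close> by simp
  also have "card (SIGMA w:W. {d \<in> down_lists n. twins d \<inter> descents w = {}})
      = card {(d, w) \<in> normal_pairs n. mset w = m}"
  proof -
    have "{(d, w) \<in> normal_pairs n. mset w = m}
        = prod.swap ` (SIGMA w:W. {d \<in> down_lists n. twins d \<inter> descents w = {}})"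
    proof (rule set_eqI)
      fix p :: "nat list \<times> nat list"
      obtain d w where p: "p = (d, w)" by (cases p)
      have "length w = n" if "mset w = m" using that by (auto simp: n_def)
      then show "p \<in> {(d, w) \<in> normal_pairs n. mset w = m} \<longleftrightarrow>
          p \<in> prod.swap ` (SIGMA w:W. {d \<in> down_lists n. twins d \<inter> descents w = {}})"
        unfolding p by (subst pair_in_swap_image) (simp add: normal_pairs_def W_def, blast)
    qed
    then show ?thesis by (simp add: card_image)
  qed
  finally show ?thesis by (simp add: n_def)
qed

section \<open>Orbits of coloured semiorders\<close>

text \<open>Burnside's count with one representative per orbit. If \<open>g y\<close> moves the
  representative \<open>T y\<close> to \<open>y\<close>, a fixed pair (\<pi>, y) corresponds to
  (\<open>\<pi> \<circ> g y\<close>, \<open>T y\<close>). As \<pi> fixes \<open>y\<close>, the new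
  permutation still moves \<open>T y\<close> to \<open>y\<close>, which makes the map invertible
  without any count of stabilizers.\<close>

lemma card_fixed_pairs_transversal:
  fixes act :: "('i::finite \<Rightarrow> 'i) \<Rightarrow> 'y \<Rightarrow> 'y"
  assumes act_comp: "\<And>\<pi> \<sigma> y. bij \<pi> \<Longrightarrow> bij \<sigma> \<Longrightarrow> act (\<pi> \<circ> \<sigma>) y = act \<pi> (act \<sigma> y)"
    and act_id: "\<And>y. act id y = y"
    and closed: "\<And>\<pi> y. bij \<pi> \<Longrightarrow> y \<in> Y \<Longrightarrow> act \<pi> y \<in> Y"
    and "N \<subseteq> Y"
    and reach: "\<And>y. y \<in> Y \<Longrightarrow> \<exists>\<pi> t. bij \<pi> \<and> t \<in> N \<and> act \<pi> t = y"
    and unique: "\<And>\<pi> s t. bij \<pi> \<Longrightarrow> s \<in> N \<Longrightarrow> t \<in> N \<Longrightarrow> act \<pi> s = t \<Longrightarrow> s = t"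
  shows "card {(\<pi>, y). bij \<pi> \<and> y \<in> Y \<and> act \<pi> y = y} = fact CARD('i) * card N"
proof -
  have "\<exists>g T. \<forall>y\<in>Y. bij (g y) \<and> T y \<in> N \<and> act (g y) (T y) = y"
    using reach by metis
  then obtain g T where gT: "\<forall>y\<in>Y. bij (g y) \<and> T y \<in> N \<and> act (g y) (T y) = y"
    by blast
  have g: "bij (g y)" and T: "T y \<in> N" "act (g y) (T y) = y" if "y \<in> Y" for y
    using gT that by auto
  have g_inv: "g y \<circ> inv (g y) = id" "inv (g y) \<circ> g y = id" if "y \<in> Y" for y
    using g[OF that] surj_iff[of "g y"] by (auto simp: bij_def inv_o_cancel)
  have act_inv: "act (inv \<pi>) (act \<pi> y) = y" if "bij \<pi>" for \<pi> y
    using act_comp[of "inv \<pi>" \<pi> y] that by (simp add: bij_imp_bij_inv bij_is_inj act_id)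
  have T_act: "T (act \<sigma> t) = t" if "bij \<sigma>" "t \<in> N" for \<sigma> t
  proof -
    let ?y = "act \<sigma> t"
    have "?y \<in> Y" using that closed \<open>N \<subseteq> Y\<close> by blast
    have "act (inv \<sigma> \<circ> g ?y) (T ?y) = t"
      using act_comp[of "inv \<sigma>" "g ?y"] that g[OF \<open>?y \<in> Y\<close>] T(2)[OF \<open>?y \<in> Y\<close>] act_inv
      by (simp add: bij_imp_bij_inv)
    then show ?thesis
      using unique[of "inv \<sigma> \<circ> g ?y"] that g[OF \<open>?y \<in> Y\<close>] T(1)[OF \<open>?y \<in> Y\<close>]
      by (simp add: bij_imp_bij_inv bij_comp)
  qed
  have "bij_betw (\<lambda>(\<pi>, y). (\<pi> \<circ> g y, T y)) {(\<pi>, y). bij \<pi> \<and> y \<in> Y \<and> act \<pi> y = y}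
      ({\<pi>. bij \<pi>} \<times> N)"
  proof (rule bij_betw_byWitness[where f' = "\<lambda>(\<sigma>, t). (\<sigma> \<circ> inv (g (act \<sigma> t)), act \<sigma> t)"])
    show "\<forall>p\<in>{(\<pi>, y). bij \<pi> \<and> y \<in> Y \<and> act \<pi> y = y}.
        (case case p of (\<pi>, y) \<Rightarrow> (\<pi> \<circ> g y, T y) of
           (\<sigma>, t) \<Rightarrow> (\<sigma> \<circ> inv (g (act \<sigma> t)), act \<sigma> t)) = p"
      using g T by (auto simp: act_comp o_assoc[symmetric] g_inv)
    show "\<forall>p\<in>{\<pi>. bij \<pi>} \<times> N.
        (case case p of (\<sigma>, t) \<Rightarrow> (\<sigma> \<circ> inv (g (act \<sigma> t)), act \<sigma> t) of
           (\<pi>, y) \<Rightarrow> (\<pi> \<circ> g y, T y)) = p"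
      using g closed \<open>N \<subseteq> Y\<close> by (auto simp: T_act o_assoc[symmetric] g_inv subset_iff)
    show "(\<lambda>(\<pi>, y). (\<pi> \<circ> g y, T y)) ` {(\<pi>, y). bij \<pi> \<and> y \<in> Y \<and> act \<pi> y = y} \<subseteq> {\<pi>. bij \<pi>} \<times> N"
      using g T by (auto simp: bij_comp)
    show "(\<lambda>(\<sigma>, t). (\<sigma> \<circ> inv (g (act \<sigma> t)), act \<sigma> t)) ` ({\<pi>. bij \<pi>} \<times> N)
        \<subseteq> {(\<pi>, y). bij \<pi> \<and> y \<in> Y \<and> act \<pi> y = y}"
    proof clarify
      fix \<sigma> :: "'i \<Rightarrow> 'i" and t assume \<sigma>: "bij \<sigma>" and t: "t \<in> N"
      define y where "y = act \<sigma> t"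
      have y: "y \<in> Y" using \<sigma> t closed \<open>N \<subseteq> Y\<close> by (auto simp: y_def)
      have "act (inv (g y)) y = T y" using act_inv[OF g[OF y], of "T y"] T(2)[OF y] by simp
      moreover have "T y = t" using T_act[OF \<sigma> t] by (simp add: y_def)
      ultimately have "act (\<sigma> \<circ> inv (g y)) y = y"
        using act_comp[of \<sigma> "inv (g y)" y] \<sigma> g[OF y] by (simp add: bij_imp_bij_inv y_def)
      then show "bij (\<sigma> \<circ> inv (g (act \<sigma> t))) \<and> act \<sigma> t \<in> Y \<and>
          act (\<sigma> \<circ> inv (g (act \<sigma> t))) (act \<sigma> t) = act \<sigma> t"
        using \<sigma> g[OF y] y by (auto simp: y_def bij_imp_bij_inv intro!: bij_comp)
    qed
  qed
  then have "card {(\<pi>, y). bij \<pi> \<and> y \<in> Y \<and> act \<pi> y = y} = card ({\<pi> :: 'i \<Rightarrow> 'i. bij \<pi>} \<times> N)"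
    by (rule bij_betw_same_card)
  moreover have "card {\<pi> :: 'i \<Rightarrow> 'i. bij \<pi>} = fact CARD('i)"
    using card_permutations[OF refl, of "UNIV :: 'i set"] by (simp add: permutes_univ bij_iff)
  ultimately show ?thesis by (simp add: card_cartesian_product)
qed

section \<open>Normal forms of coloured semiorders\<close>

lemma initial_segment_eq_lessThan_card:
  fixes I :: "nat set"
  assumes "finite I" "\<And>a b. a \<in> I \<Longrightarrow> b \<le> a \<Longrightarrow> b \<in> I"
  shows "I = {..<card I}"
proof (cases "I = {}")
  case False
  then have "I = {..Max I}"
    using assms(2)[OF Max_in[OF \<open>finite I\<close>]] Max_ge[OF \<open>finite I\<close>] by blast
  then have "card I = Suc (Max I)" by (metis card_atMost)
  then show ?thesis using \<open>I = {..Max I}\<close> by (metis lessThan_Suc_atMost)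
qed simp

definition coloured_act :: "('i \<Rightarrow> 'i) \<Rightarrow> 'i rel \<times> ('i \<Rightarrow> nat) \<Rightarrow> 'i rel \<times> ('i \<Rightarrow> nat)" where
  "coloured_act \<pi> = (\<lambda>(r, c). (map_prod \<pi> \<pi> ` r, c \<circ> inv \<pi>))"

lemma coloured_act_comp:
  assumes "bij \<pi>" "bij \<sigma>"
  shows "coloured_act (\<pi> \<circ> \<sigma>) y = coloured_act \<pi> (coloured_act \<sigma> y)"
  using assms by (simp add: coloured_act_def o_inv_distrib image_image o_assoc prod.map_comp split: prod.split)

lemma coloured_act_id: "coloured_act id y = y"
  by (auto simp: coloured_act_def prod.map_id0 split: prod.splits)

text \<open>
  Sorting the elements of a coloured semiorder by this key, lexicographically, brings it into the
  normal form below.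
\<close>

definition key :: "'i::finite rel \<times> ('i \<Rightarrow> nat) \<Rightarrow> 'i \<Rightarrow> nat list" where
  "key = (\<lambda>(r, c) i. [card {j. (j, i) \<in> r}, CARD('i) - card {j. (i, j) \<in> r}, c i])"

lemma key_coloured_act:
  assumes "bij \<pi>"
  shows "key (coloured_act \<pi> y) (\<pi> i) = key y i"
proof -
  obtain r c where y: "y = (r, c)" by (cases y)
  have inj: "inj \<pi>" and surj: "surj \<pi>" using assms by (auto simp: bij_def)
  have "{j. (j, \<pi> i) \<in> map_prod \<pi> \<pi> ` r} = \<pi> ` {j. (j, i) \<in> r}"
       "{j. (\<pi> i, j) \<in> map_prod \<pi> \<pi> ` r} = \<pi> ` {j. (i, j) \<in> r}"
    using inj by (force simp: inj_def)+
  moreover have "card (\<pi> ` A) = card A" for A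
    using inj by (meson card_image inj_on_subset subset_UNIV)
  ultimately show ?thesis
    using inj by (simp add: y key_def coloured_act_def)
qed

text \<open>A pair on the positions, carried over to the index type by a numbering \<open>e\<close>.
  One fixed \<open>e\<close> serves for all pairs, since the action absorbs relabellings.\<close>

definition model :: "('i \<Rightarrow> nat) \<Rightarrow> nat list \<times> nat list \<Rightarrow> 'i rel \<times> ('i \<Rightarrow> nat)" where
  "model e = (\<lambda>(d, w). ({(i, j). e i < d ! e j}, \<lambda>i. w ! e i))"

definition list_key :: "nat \<Rightarrow> nat list \<Rightarrow> nat list \<Rightarrow> nat \<Rightarrow> nat list" where
  "list_key n d w j = [d ! j, n - card {b. b < n \<and> j < d ! b}, w ! j]"

lemma card_vimage_bij_betw:
  assumes "bij_betw e UNIV {..<n}"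
  shows "card {i. P (e i)} = card {a. a < n \<and> P a}"
proof (rule bij_betw_same_card)
  show "bij_betw e {i. P (e i)} {a. a < n \<and> P a}"
    using assms by (auto simp: bij_betw_def inj_on_def)
qed

lemma key_model:
  fixes e :: "'i::finite \<Rightarrow> nat"
  assumes e: "bij_betw e UNIV {..<CARD('i)}" and d: "d \<in> down_lists CARD('i)"
  shows "key (model e (d, w)) i = list_key CARD('i) d w (e i)"
proof -
  have "e i < CARD('i)" using e by (auto simp: bij_betw_def)
  then have "d ! e i \<le> e i" "e i < CARD('i)" using d by (auto simp: down_lists_def)
  then have "{a. a < CARD('i) \<and> a < d ! e i} = {..<d ! e i}" by auto
  then have "card {j. e j < d ! e i} = d ! e i"
    using card_vimage_bij_betw[OF e, of "\<lambda>a. a < d ! e i"] by simp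
  moreover have "card {j. e i < d ! e j} = card {b. b < CARD('i) \<and> e i < d ! b}"
    by (rule card_vimage_bij_betw[OF e])
  ultimately show ?thesis
    by (simp add: key_def model_def list_key_def)
qed

lemma twins_iff_same_up:
  assumes "Suc j \<notin> set d" "length d = n"
  shows "{b. b < n \<and> Suc j < d ! b} = {b. b < n \<and> j < d ! b}"
  using assms by (metis (no_types, lifting) Suc_lessD Suc_lessI nth_mem)

text \<open>The first two entries increase weakly because \<open>d\<close> does and the up-sets
  shrink. If both agree, nested up-sets of equal size coincide, so \<open>j\<close> is a twin and
  the colours have no descent there.\<close>

lemma sorted_list_key:
  assumes "(d, w) \<in> normal_pairs n"
  shows "sorted (map (list_key n d w) [0..<n])"
  unfolding sorted_iff_nth_Suc
proof (intro allI impI)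
  fix j assume "Suc j < length (map (list_key n d w) [0..<n])"
  then have j: "Suc j < n" by simp
  have d: "d \<in> down_lists n" and w: "length w = n" and tw: "twins d \<inter> descents w = {}"
    using assms by (auto simp: normal_pairs_def)
  have len: "length d = n" and "sorted d" using d by (auto simp: down_lists_def)
  then have le: "d ! j \<le> d ! Suc j" using j by (simp add: sorted_iff_nth_Suc)
  let ?U = "\<lambda>j. card {b. b < n \<and> j < d ! b}"
  have sub: "?U (Suc j) \<le> ?U j" by (rule card_mono) auto
  have "list_key n d w j \<le> list_key n d w (Suc j)"
  proof (cases "d ! j = d ! Suc j \<and> ?U (Suc j) = ?U j")
    case False
    have "?U j \<le> n" using card_mono[of "{..<n}" "{b. b < n \<and> j < d ! b}"] by auto
    then show ?thesis using False le sub by (auto simp: list_key_def)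
  next
    case True
    have eq: "{b. b < n \<and> Suc j < d ! b} = {b. b < n \<and> j < d ! b}"
      using True by (intro card_subset_eq) auto
    have "Suc j \<notin> set d"
    proof
      assume "Suc j \<in> set d"
      then obtain b where "b < n" "d ! b = Suc j" using len by (auto simp: in_set_conv_nth)
      then have "b \<in> {b. b < n \<and> j < d ! b}" "b \<notin> {b. b < n \<and> Suc j < d ! b}" by auto
      then show False using eq by blast
    qed
    then have "j \<in> twins d" using True j len by (simp add: twins_def)
    then have "j \<notin> descents w" using tw by auto
    then show ?thesis using True j w by (auto simp: list_key_def descents_def)
  qed
  then show "map (list_key n d w) [0..<n] ! j \<le> map (list_key n d w) [0..<n] ! Suc j"
    using j by simp
qed

text \<open>The multiset of keys is invariant under the action. A normal pair lists its keys in
  sorted order, so the multiset determines the list, from which \<open>d\<close> and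
  \<open>w\<close> can be read off.\<close>

lemma model_unique:
  fixes e :: "'i::finite \<Rightarrow> nat"
  assumes e: "bij_betw e UNIV {..<CARD('i)}" and \<pi>: "bij \<pi>"
    and dw: "(d, w) \<in> normal_pairs CARD('i)" and dw': "(d', w') \<in> normal_pairs CARD('i)"
    and eq: "coloured_act \<pi> (model e (d, w)) = model e (d', w')"
  shows "d = d' \<and> w = w'"
proof -
  let ?n = "CARD('i)"
  have keys: "mset (map (list_key ?n d w) [0..<?n]) = image_mset (key (model e (d, w))) (mset_set UNIV)"
    if "(d, w) \<in> normal_pairs ?n" for d w
  proof -
    have "image_mset (key (model e (d, w))) (mset_set UNIV) = image_mset (\<lambda>i. list_key ?n d w (e i)) (mset_set UNIV)"
      using that by (intro image_mset_cong key_model[OF e]) (auto simp: normal_pairs_def)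
    also have "\<dots> = image_mset (list_key ?n d w) (image_mset e (mset_set UNIV))"
      by (simp add: multiset.map_comp o_def)
    also have "image_mset e (mset_set UNIV) = mset_set {..<?n}"
      using e by (metis bij_betw_def image_mset_mset_set)
    finally show ?thesis by (simp add: atLeast0LessThan mset_upt)
  qed
  have "image_mset (key (model e (d', w'))) (mset_set UNIV)
      = image_mset (key (model e (d', w'))) (image_mset \<pi> (mset_set UNIV))"
    using \<pi> by (simp add: image_mset_mset_set bij_def)
  also have "\<dots> = image_mset (\<lambda>i. key (model e (d', w')) (\<pi> i)) (mset_set UNIV)"
    by (simp add: multiset.map_comp o_def)
  also have "\<dots> = image_mset (key (model e (d, w))) (mset_set UNIV)"
    by (simp add: eq[symmetric] key_coloured_act[OF \<pi>])
  finally have "map (list_key ?n d w) [0..<?n] = map (list_key ?n d' w') [0..<?n]"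
    using keys[OF dw] keys[OF dw'] sorted_list_key[OF dw] sorted_list_key[OF dw']
    by (metis sorted_sort_id properties_for_sort)
  then have "list_key ?n d w j = list_key ?n d' w' j" if "j < ?n" for j
    using that by (metis (no_types, lifting) atLeastLessThan_iff le0 map_eq_conv set_upt)
  then show ?thesis
    using dw dw' by (auto simp: list_key_def normal_pairs_def down_lists_def intro!: nth_equalityI)
qed

text \<open>Otherwise f a < f b, so \<open>a\<close> has at most as many elements below it as
  \<open>b\<close> and strictly more above it. As the key subtracts the size of the up-set, the key
  of \<open>a\<close> would be strictly smaller than that of \<open>b\<close>.\<close>

lemma semiorder_down_closed:
  fixes f :: "'i::finite \<Rightarrow> real"
  defines "r \<equiv> {(i, j). f i + 1 < f j}"
  assumes ay: "(a, y) \<in> r" and le: "key (r, c) b \<le> key (r, c) a"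
  shows "(b, y) \<in> r"
proof (rule ccontr)
  assume "(b, y) \<notin> r"
  then have ab: "f a < f b" and y: "(b, y) \<notin> r" using ay by (auto simp: r_def)
  have "{j. (j, a) \<in> r} \<subseteq> {j. (j, b) \<in> r}" using ab by (auto simp: r_def)
  then have down: "card {j. (j, a) \<in> r} \<le> card {j. (j, b) \<in> r}" by (intro card_mono) auto
  have "{j. (b, j) \<in> r} \<subset> {j. (a, j) \<in> r}" using ab ay y by (auto simp: r_def)
  then have up: "card {j. (b, j) \<in> r} < card {j. (a, j) \<in> r}" by (intro psubset_card_mono) auto
  have "card {j. (a, j) \<in> r} \<le> CARD('i)" by (intro card_mono) auto
  then show False using le down up by (auto simp: key_def)
qed

lemma model_exists:
  fixes e :: "'i::finite \<Rightarrow> nat" and f :: "'i \<Rightarrow> real"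
  assumes e: "bij_betw e UNIV {..<CARD('i)}" and r: "r = {(i, j). f i + 1 < f j}"
  shows "\<exists>\<pi> d w. bij \<pi> \<and> (d, w) \<in> normal_pairs CARD('i) \<and> coloured_act \<pi> (model e (d, w)) = (r, c)"
proof -
  let ?n = "CARD('i)"
  define k where "k = key (r, c)"
  define down where "down i = card {j. (j, i) \<in> r}" for i
  obtain ys :: "'i list" where ys: "set ys = UNIV" "distinct ys"
    using finite_distinct_list[OF finite[of "UNIV :: 'i set"]] by blast
  define xs where "xs = sort_key k ys"
  have xs: "set xs = UNIV" "distinct xs" using ys by (simp_all add: xs_def)
  then have len: "length xs = ?n" by (metis distinct_card)
  have nth_bij: "bij_betw (nth xs) {..<?n} UNIV"
    using bij_betw_nth[OF xs(2)] len xs(1) by simp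
  have mono: "k (xs ! i) \<le> k (xs ! j)" if "i \<le> j" "j < ?n" for i j
    using sorted_nth_mono[of "map k xs" i j] that len by (simp add: xs_def)
  \<comment> \<open>In key order the elements below a given one form an initial segment, so their
    number alone determines them.\<close>
  have rel: "(xs ! a, xs ! b) \<in> r \<longleftrightarrow> a < down (xs ! b)" if "a < ?n" for a b
  proof -
    let ?I = "{a. a < ?n \<and> (xs ! a, xs ! b) \<in> r}"
    have "?I = {..<card ?I}"
    proof (rule initial_segment_eq_lessThan_card)
      fix a a' assume "a \<in> ?I" "a' \<le> a"
      then show "a' \<in> ?I"
        using semiorder_down_closed[of "xs ! a" "xs ! b" f c "xs ! a'"] mono[of a' a]
        by (auto simp: r k_def)
    qed simp
    moreover have "card ?I = down (xs ! b)"
      unfolding down_def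
    proof (rule bij_betw_same_card)
      show "bij_betw (nth xs) ?I {j. (j, xs ! b) \<in> r}"
        using nth_bij by (auto simp: bij_betw_def inj_on_def)
    qed
    ultimately show ?thesis using that by auto
  qed
  define d where "d = map down xs"
  define w where "w = map c xs"
  have d_nth: "d ! j = down (xs ! j)" if "j < ?n" for j using that len by (simp add: d_def)
  have dl: "d \<in> down_lists ?n"
  proof -
    have "d ! i \<le> d ! j" if "i < j" "j < ?n" for i j
      using mono[of i j] that by (auto simp: d_nth k_def key_def down_def split: prod.splits)
    then have "sorted d" by (simp add: sorted_iff_nth_mono_less d_def len)
    \<comment> \<open>No element is below itself, so the initial segment of elements below
      \<open>xs ! j\<close> stops before position \<open>j\<close>.\<close>
    moreover have "d ! j \<le> j" if "j < ?n" for j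
      using rel[OF that, of j] that by (auto simp: d_nth r)
    ultimately show ?thesis by (simp add: down_lists_def d_def len)
  qed
  \<comment> \<open>Twins agree in the first two entries of the key, so the sorting has compared
    their colours.\<close>
  have "j \<notin> descents w" if "j \<in> twins d" for j
  proof -
    have j: "Suc j < ?n" and eq: "d ! j = d ! Suc j" and nin: "Suc j \<notin> set d"
      using that len by (auto simp: twins_def d_def)
    have up: "card {i. (xs ! j, i) \<in> r} = card {b. b < ?n \<and> j < d ! b}" if "j < ?n" for j
    proof (rule sym, rule bij_betw_same_card)
      have "{b. b < ?n \<and> j < d ! b} = {b. b < ?n \<and> (xs ! j, xs ! b) \<in> r}"
        using that by (auto simp: d_nth rel)
      then show "bij_betw (nth xs) {b. b < ?n \<and> j < d ! b} {i. (xs ! j, i) \<in> r}"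
        using nth_bij by (auto simp: bij_betw_def inj_on_def)
    qed
    have "card {i. (xs ! j, i) \<in> r} = card {i. (xs ! Suc j, i) \<in> r}"
      using j up[of j] up[of "Suc j"] twins_iff_same_up[OF nin, of ?n] by (simp add: d_def len)
    moreover have "k (xs ! j) \<le> k (xs ! Suc j)" using mono j by simp
    ultimately have "c (xs ! j) \<le> c (xs ! Suc j)"
      using eq j by (auto simp: k_def key_def d_nth down_def)
    then show ?thesis using j len by (auto simp: descents_def w_def)
  qed
  then have "(d, w) \<in> normal_pairs ?n"
    using dl by (auto simp: normal_pairs_def w_def len)
  moreover define \<pi> where "\<pi> = (\<lambda>i. xs ! e i)"
  have \<pi>: "bij \<pi>"
    using bij_betw_trans[OF e nth_bij] by (simp add: \<pi>_def o_def)
  moreover have "coloured_act \<pi> (model e (d, w)) = (r, c)"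
  proof -
    have en: "e i < ?n" for i using e by (auto simp: bij_betw_def)
    have "(\<pi> i, \<pi> j) \<in> r \<longleftrightarrow> e i < d ! e j" for i j
      using en[of i] en[of j] by (simp add: \<pi>_def rel d_nth)
    moreover have "r = map_prod \<pi> \<pi> ` {(i, j). (\<pi> i, \<pi> j) \<in> r}"
    proof (intro equalityI subsetI)
      fix p assume "p \<in> r"
      moreover have "p = (\<pi> (inv \<pi> (fst p)), \<pi> (inv \<pi> (snd p)))"
        using \<pi> by (simp add: bij_is_surj surj_f_inv_f)
      ultimately show "p \<in> map_prod \<pi> \<pi> ` {(i, j). (\<pi> i, \<pi> j) \<in> r}"
        by (intro image_eqI[of _ _ "(inv \<pi> (fst p), inv \<pi> (snd p))"]) auto
    qed auto
    moreover have "w ! e i = c (\<pi> i)" for i using en[of i] len by (simp add: w_def \<pi>_def)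
    ultimately show ?thesis
      using \<pi> by (simp add: coloured_act_def model_def o_def bij_is_surj surj_f_inv_f)
  qed
  ultimately show ?thesis by blast
qed

section \<open>Power sums and colourings\<close>

text \<open>Expanding the product chooses one variable for each set P, raised to the power
  \<open>card P\<close>. The choice functions are extensional so that they can be counted.\<close>

lemma coeff_at_prod_power_sum:
  fixes \<O> :: "'b set set"
  assumes "finite \<O>" "\<forall>P\<in>\<O>. finite P \<and> P \<noteq> {}"
  shows "coeff_at (\<Prod>P\<in>\<O>. power_sum (card P) :: 'a::comm_ring_1 mseries) m
    = of_nat (card {g \<in> \<O> \<rightarrow>\<^sub>E {1..}. (\<Sum>P\<in>\<O>. replicate_mset (card P) (g P)) = m})"
  using assms
proof (induction \<O> arbitrary: m rule: finite_induct)
  case empty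
  then show ?case by (auto simp: coeff_at_one)
next
  case (insert Q \<O>)
  define k where "k = card Q"
  have k: "k > 0" using insert.prems by (simp add: k_def card_gt_0_iff)
  define X where "X \<O> m = {g \<in> \<O> \<rightarrow>\<^sub>E {1::nat..}. (\<Sum>P\<in>\<O>. replicate_mset (card P) (g P)) = m}"
    for \<O> :: "'b set set" and m
  have sum_ins: "(\<Sum>P\<in>insert Q \<O>. replicate_mset (card P) (g P))
      = replicate_mset k (g Q) + (\<Sum>P\<in>\<O>. replicate_mset (card P) (g P))" for g :: "_ \<Rightarrow> nat"
    using insert.hyps by (simp add: k_def)
  have sum_upd: "(\<Sum>P\<in>\<O>. replicate_mset (card P) (if P = Q then i else g P)) = (\<Sum>P\<in>\<O>. replicate_mset (card P) (g P))"
    for g :: "_ \<Rightarrow> nat" and i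
    using insert.hyps by (intro sum.cong) auto
  have finX: "finite (X \<O> m)" if "finite \<O>" "\<forall>P\<in>\<O>. finite P \<and> P \<noteq> {}" for \<O> :: "'b set set" and m
  proof (rule finite_subset)
    show "X \<O> m \<subseteq> \<O> \<rightarrow>\<^sub>E set_mset m"
    proof
      fix g assume g: "g \<in> X \<O> m"
      have "g P \<in># m" if "P \<in> \<O>" for P
      proof -
        have "g P \<in># replicate_mset (card P) (g P)"
          using \<open>\<forall>P\<in>\<O>. finite P \<and> P \<noteq> {}\<close> that by (simp add: card_gt_0_iff)
        then have "g P \<in># (\<Sum>P\<in>\<O>. replicate_mset (card P) (g P))"
          unfolding set_mset_sum[OF \<open>finite \<O>\<close>] using that by blast
        then show ?thesis using g by (simp add: X_def)
      qed
      then show "g \<in> \<O> \<rightarrow>\<^sub>E set_mset m" using g by (auto simp: X_def PiE_def)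
    qed
  qed (use that in \<open>simp add: finite_PiE\<close>)
  define I where "I = {(a, b) \<in> splits m. \<exists>i\<ge>1. a = replicate_mset k i}"
  have "finite I" by (rule finite_subset[OF _ finite_splits[of m]]) (auto simp: I_def)
  have "coeff_at (\<Prod>P\<in>insert Q \<O>. power_sum (card P) :: 'a mseries) m
      = (\<Sum>(a, b)\<in>splits m. (if \<exists>i\<ge>1. a = replicate_mset k i then 1 else 0) * of_nat (card (X \<O> b)))"
    using insert by (simp add: coeff_at_mult coeff_at_power_sum k_def X_def)
  also have "\<dots> = (\<Sum>p\<in>I. of_nat (card (X \<O> (snd p))))"
    by (rule sum.mono_neutral_cong_right) (auto simp: I_def split: if_splits)
  also have "\<dots> = of_nat (card (SIGMA p:I. X \<O> (snd p)))"
    using \<open>finite I\<close> finX insert by simp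
  also have "card (SIGMA p:I. X \<O> (snd p)) = card (X (insert Q \<O>) m)"
  proof (rule bij_betw_same_card, rule bij_betw_byWitness)
    let ?s = "\<lambda>g. \<Sum>P\<in>\<O>. replicate_mset (card P) (g P :: nat)"
    let ?f = "\<lambda>((a :: nat multiset, b :: nat multiset), g). g(Q := (THE i. a = replicate_mset k i))"
    let ?f' = "\<lambda>g. ((replicate_mset k (g Q), ?s g), g(Q := undefined))"
    \<comment> \<open>The variable can be recovered from its power because the exponent
      \<open>k\<close> is positive.\<close>
    have the: "(THE i. replicate_mset k j = replicate_mset k i) = j" for j :: nat
    proof (rule the_equality)
      fix i assume "replicate_mset k j = replicate_mset k i"
      then have "set_mset (replicate_mset k j) = set_mset (replicate_mset k i)" by simp
      then show "i = j" using k by simp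
    qed simp
    show "\<forall>q\<in>(SIGMA p:I. X \<O> (snd p)). ?f' (?f q) = q"
      using insert.hyps by (auto simp: I_def X_def the sum_upd PiE_def extensional_def fun_eq_iff)
    show "\<forall>g\<in>X (insert Q \<O>) m. ?f (?f' g) = g"
      by (auto simp: the)
    show "?f ` (SIGMA p:I. X \<O> (snd p)) \<subseteq> X (insert Q \<O>) m"
    proof clarify
      fix a b g assume ab: "(a, b) \<in> I" and g: "g \<in> X \<O> (snd (a, b))"
      then obtain i where i: "i \<ge> 1" "a = replicate_mset k i" "a + b = m"
        by (auto simp: I_def splits_def)
      have "g(Q := i) \<in> insert Q \<O> \<rightarrow>\<^sub>E {1..}"
        using g i by (auto simp: X_def PiE_def extensional_def)
      then show "g(Q := (THE i. a = replicate_mset k i)) \<in> X (insert Q \<O>) m"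
        using i g sum_ins[of "g(Q := i)"] by (simp add: i the X_def sum_upd)
    qed
    show "?f' ` X (insert Q \<O>) m \<subseteq> (SIGMA p:I. X \<O> (snd p))"
    proof (rule image_subsetI)
      fix g assume g: "g \<in> X (insert Q \<O>) m"
      then have "replicate_mset k (g Q) + ?s g = m" "g Q \<ge> 1"
        using sum_ins[of g] by (auto simp: X_def)
      moreover have "g(Q := undefined) \<in> X \<O> (?s g)"
        using g insert.hyps by (auto simp: X_def sum_upd PiE_def extensional_def)
      ultimately show "((replicate_mset k (g Q), ?s g), g(Q := undefined)) \<in> (SIGMA p:I. X \<O> (snd p))"
        by (auto simp: I_def splits_def)
    qed
  qed
  finally show ?case by (simp add: X_def)
qed

text \<open>A colouring fixed by \<pi> is constant on cycles, so it amounts to one colour per cycle,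
  and a cycle of length k with colour i contributes x_i^k.\<close>

lemma coeff_at_prod_cycle_type:
  fixes \<pi> :: "'i::finite \<Rightarrow> 'i"
  assumes \<pi>: "bij \<pi>"
  shows "coeff_at (\<Prod>k\<in>#cycle_type UNIV \<pi>. power_sum k :: 'a::comm_ring_1 mseries) m
    = of_nat (card {c. (\<forall>i. c i \<ge> 1) \<and> c \<circ> \<pi> = c \<and> image_mset c (mset_set UNIV) = m})"
proof -
  define \<O> where "\<O> = range (orbit \<pi>)"
  have perm: "permutation \<pi>"
    using \<pi> by (simp add: permutation)
  have self: "i \<in> orbit \<pi> i" for i
    using perm by (rule permutation_self_in_orbit)
  have orbit_eq: "orbit \<pi> j = orbit \<pi> i" if "j \<in> orbit \<pi> i" for i j
    by (rule orbit_cyclic_eq3[OF cyclic_on_orbit'[OF perm] that])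
  have step: "orbit \<pi> (\<pi> i) = orbit \<pi> i" for i
    using orbit_eq[of "\<pi> i" i] by (simp add: orbit.base)
  have singletons: "(\<Sum>i\<in>A. {#f i#}) = image_mset f (mset_set A)" for f :: "'i \<Rightarrow> nat" and A
    by (induction A rule: infinite_finite_induct) auto
  have content: "(\<Sum>P\<in>\<O>. replicate_mset (card P) (g P)) = image_mset (\<lambda>i. g (orbit \<pi> i)) (mset_set UNIV)"
    for g :: "'i set \<Rightarrow> nat"
  proof -
    have "image_mset (\<lambda>i. g (orbit \<pi> i)) (mset_set UNIV) = (\<Sum>i\<in>UNIV. {#g (orbit \<pi> i)#})"
      by (rule singletons[symmetric])
    also have "\<dots> = (\<Sum>P\<in>\<O>. \<Sum>i\<in>{i \<in> UNIV. orbit \<pi> i = P}. {#g (orbit \<pi> i)#})"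
      unfolding \<O>_def by (rule sum.image_gen) simp
    also have "\<dots> = (\<Sum>P\<in>\<O>. replicate_mset (card P) (g P))"
    proof (intro sum.cong refl)
      fix Q assume "Q \<in> \<O>"
      then have "{i \<in> UNIV. orbit \<pi> i = Q} = Q"
        using orbit_eq self by (auto simp: \<O>_def)
      moreover have "(\<Sum>i\<in>Q. {#x#}) = replicate_mset (card Q) x" for x :: nat
        by (induction Q rule: infinite_finite_induct) auto
      ultimately show "(\<Sum>i\<in>{i \<in> UNIV. orbit \<pi> i = Q}. {#g (orbit \<pi> i)#}) = replicate_mset (card Q) (g Q)"
        by (metis (mono_tags, lifting) mem_Collect_eq sum.cong)
    qed
    finally show ?thesis by simp
  qed
  have "(\<Prod>k\<in>#cycle_type UNIV \<pi>. power_sum k :: 'a mseries) = (\<Prod>P\<in>\<O>. power_sum (card P))"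
    by (simp add: cycle_type_def \<O>_def prod_unfold_prod_mset multiset.map_comp o_def)
  then have "coeff_at (\<Prod>k\<in>#cycle_type UNIV \<pi>. power_sum k :: 'a mseries) m
      = of_nat (card {g \<in> \<O> \<rightarrow>\<^sub>E {1..}. (\<Sum>P\<in>\<O>. replicate_mset (card P) (g P)) = m})"
    using self by (subst coeff_at_prod_power_sum[symmetric]) (auto simp: \<O>_def)
  also have "card {g \<in> \<O> \<rightarrow>\<^sub>E {1..}. (\<Sum>P\<in>\<O>. replicate_mset (card P) (g P)) = m}
      = card {c. (\<forall>i. c i \<ge> 1) \<and> c \<circ> \<pi> = c \<and> image_mset c (mset_set UNIV) = m}"
  proof (rule bij_betw_same_card, rule bij_betw_byWitness)
    let ?f = "\<lambda>g i. g (orbit \<pi> i) :: nat"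
    let ?f' = "\<lambda>c. restrict (\<lambda>P. c (SOME i. i \<in> P) :: nat) \<O>"
    have some: "(SOME i. i \<in> Q) \<in> Q" if "Q \<in> \<O>" for Q
      using that by (auto simp: \<O>_def some_in_eq orbit_nonempty)
    have const: "c j = c i" if "c \<circ> \<pi> = c" "j \<in> orbit \<pi> i" for c :: "'i \<Rightarrow> nat" and i j
      using that(2) by induction (use that(1) in \<open>auto simp: fun_eq_iff\<close>)
    have f'f: "?f (?f' c) = c" if "c \<circ> \<pi> = c" for c
      using const[OF that some] by (auto simp: \<O>_def fun_eq_iff)
    show "\<forall>g\<in>{g \<in> \<O> \<rightarrow>\<^sub>E {1..}. (\<Sum>P\<in>\<O>. replicate_mset (card P) (g P)) = m}. ?f' (?f g) = g"
    proof
      fix g assume "g \<in> {g \<in> \<O> \<rightarrow>\<^sub>E {1..}. (\<Sum>P\<in>\<O>. replicate_mset (card P) (g P)) = m}"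
      then have g: "g \<in> extensional \<O>" by (auto simp: PiE_def)
      have "orbit \<pi> (SOME i. i \<in> Q) = Q" if "Q \<in> \<O>" for Q
        using some[OF that] that orbit_eq by (auto simp: \<O>_def)
      then show "?f' (?f g) = g"
        using g by (auto simp: fun_eq_iff extensional_def restrict_def)
    qed
    show "\<forall>c\<in>{c. (\<forall>i. c i \<ge> 1) \<and> c \<circ> \<pi> = c \<and> image_mset c (mset_set UNIV) = m}. ?f (?f' c) = c"
      using f'f by blast
    show "?f ` {g \<in> \<O> \<rightarrow>\<^sub>E {1..}. (\<Sum>P\<in>\<O>. replicate_mset (card P) (g P)) = m}
        \<subseteq> {c. (\<forall>i. c i \<ge> 1) \<and> c \<circ> \<pi> = c \<and> image_mset c (mset_set UNIV) = m}"
      unfolding content by (auto simp: \<O>_def fun_eq_iff step)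
    show "?f' ` {c. (\<forall>i. c i \<ge> 1) \<and> c \<circ> \<pi> = c \<and> image_mset c (mset_set UNIV) = m}
        \<subseteq> {g \<in> \<O> \<rightarrow>\<^sub>E {1..}. (\<Sum>P\<in>\<O>. replicate_mset (card P) (g P)) = m}"
      unfolding content using f'f by auto
  qed
  finally show ?thesis .
qed

section \<open>Regions\<close>

definition semiorder_of :: "real ^ 'n \<Rightarrow> 'n rel" where
  "semiorder_of x = {(i, j). x $ i + 1 < x $ j}"

definition generic_points :: "(real ^ 'n) set" where
  "generic_points = - \<Union>semiorder_arrangement"

definition generic_semiorders :: "'n::finite rel set" where
  "generic_semiorders = semiorder_of ` generic_points"

lemma mem_generic_points: "x \<in> generic_points \<longleftrightarrow> (\<forall>i j. i \<noteq> j \<longrightarrow> x $ i - x $ j \<noteq> 1)"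
  by (auto simp: generic_points_def semiorder_arrangement_def)

lemma semiorder_of_permute_coords:
  assumes "bij \<pi>"
  shows "semiorder_of (permute_coords \<pi> x) = map_prod \<pi> \<pi> ` semiorder_of x"
proof -
  have "p \<in> map_prod \<pi> \<pi> ` semiorder_of x" if "p \<in> semiorder_of (permute_coords \<pi> x)" for p
  proof (rule image_eqI)
    show "p = map_prod \<pi> \<pi> (inv \<pi> (fst p), inv \<pi> (snd p))"
      using assms by (simp add: bij_is_surj surj_f_inv_f)
    show "(inv \<pi> (fst p), inv \<pi> (snd p)) \<in> semiorder_of x"
      using that by (auto simp: semiorder_of_def permute_coords_def)
  qed
  moreover have "map_prod \<pi> \<pi> ` semiorder_of x \<subseteq> semiorder_of (permute_coords \<pi> x)"
    using assms by (auto simp: semiorder_of_def permute_coords_def bij_is_inj)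
  ultimately show ?thesis by blast
qed

lemma permute_coords_generic:
  assumes "bij \<pi>" "x \<in> generic_points"
  shows "permute_coords \<pi> x \<in> generic_points"
  using assms bij_imp_bij_inv[OF assms(1)]
  by (auto simp: mem_generic_points permute_coords_def bij_def inj_eq)

text \<open>Within a connected set of generic points, no difference of coordinates can pass the
  value 1. Conversely, points with the same semiorder lie on the same side of every hyperplane, and
  so does the segment between them.\<close>

lemma connected_component_generic_points:
  fixes x :: "real ^ 'n"
  assumes x: "x \<in> generic_points"
  shows "connected_component_set generic_points x = {y \<in> generic_points. semiorder_of y = semiorder_of x}"
proof (intro equalityI subsetI)
  fix y assume "y \<in> connected_component_set generic_points x"
  then obtain T where T: "connected T" "T \<subseteq> generic_points" "x \<in> T" "y \<in> T"
    by (auto simp: connected_component_def)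
  have same: "v $ i + 1 < v $ j" if uv: "u \<in> T" "v \<in> T" and less: "u $ i + 1 < u $ j" for u v i j
  proof (rule ccontr)
    assume "\<not> v $ i + 1 < v $ j"
    moreover have "inner (axis j 1 - axis i 1) z = z $ j - z $ i" for z :: "real ^ 'n"
      by (simp add: inner_diff_left inner_axis')
    ultimately have "\<exists>z\<in>T. inner (axis j 1 - axis i 1) z = 1"
      using uv less by (intro connected_ivt_hyperplane[OF T(1) uv(2) uv(1)]) auto
    then obtain z where "z \<in> T" "z $ j - z $ i = 1"
      using \<open>\<And>z. inner (axis j 1 - axis i 1) z = z $ j - z $ i\<close> by auto
    moreover from this have "i \<noteq> j" by auto
    ultimately show False using T(2) by (auto simp: mem_generic_points)
  qed
  then have "semiorder_of y = semiorder_of x"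
    using T same unfolding semiorder_of_def by blast
  then show "y \<in> {y \<in> generic_points. semiorder_of y = semiorder_of x}" using T by auto
next
  fix y assume "y \<in> {y \<in> generic_points. semiorder_of y = semiorder_of x}"
  then have y: "y \<in> generic_points" "semiorder_of y = semiorder_of x" by auto
  have "closed_segment x y \<subseteq> generic_points"
  proof
    fix z assume "z \<in> closed_segment x y"
    then obtain u where u: "0 \<le> u" "u \<le> 1" and z: "z = (1 - u) *\<^sub>R x + u *\<^sub>R y"
      by (auto simp: closed_segment_def)
    have "z $ i - z $ j \<noteq> 1" if "i \<noteq> j" for i j
    proof -
      define a where "a = x $ i - x $ j - 1"
      define b where "b = y $ i - y $ j - 1"
      have "x $ i - x $ j \<noteq> 1" "y $ i - y $ j \<noteq> 1"
        using x y that by (auto simp: mem_generic_points)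
      moreover have "x $ j + 1 < x $ i \<longleftrightarrow> y $ j + 1 < y $ i"
        using y(2) by (auto simp: semiorder_of_def set_eq_iff)
      ultimately have "(a > 0 \<and> b > 0) \<or> (a < 0 \<and> b < 0)"
        by (auto simp: a_def b_def)
      then have "(1 - u) * a + u * b \<noteq> 0"
        using convex_bound_lt[of "- a" 0 "- b" "1 - u" u] convex_bound_lt[of a 0 b "1 - u" u] u by auto
      moreover have "(1 - u) * a + u * b = z $ i - z $ j - 1"
        by (simp add: a_def b_def z algebra_simps)
      ultimately show ?thesis by auto
    qed
    then show "z \<in> generic_points" by (simp add: mem_generic_points)
  qed
  then show "y \<in> connected_component_set generic_points x"
    by (auto intro: connected_component_of_subset[of "closed_segment x y"]
        connected_componentI[OF connected_segment order_refl])
qed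

definition region_of :: "'n::finite rel \<Rightarrow> (real ^ 'n) set" where
  "region_of r = {y \<in> generic_points. semiorder_of y = r}"

lemma regions_semiorder_arrangement:
  "regions (semiorder_arrangement :: (real ^ 'n::finite) set set) = region_of ` generic_semiorders"
proof -
  have "regions semiorder_arrangement = connected_component_set generic_points ` (generic_points :: (real ^ 'n) set)"
    by (auto simp: regions_def components_def generic_points_def)
  also have "\<dots> = (\<lambda>x. region_of (semiorder_of x)) ` generic_points"
    by (intro image_cong refl) (simp add: connected_component_generic_points region_of_def)
  finally show ?thesis by (simp add: generic_semiorders_def image_image)
qed

lemma region_of_inject:
  assumes "r \<in> generic_semiorders" "region_of r = region_of r'"
  shows "r = r'"
  using assms by (auto simp: generic_semiorders_def region_of_def)

lemma generic_semiorders_closed: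
  fixes \<pi> :: "'n::finite \<Rightarrow> 'n"
  assumes "bij \<pi>" "r \<in> generic_semiorders"
  shows "map_prod \<pi> \<pi> ` r \<in> generic_semiorders"
  using assms(2) permute_coords_generic[OF assms(1)]
  by (auto simp: generic_semiorders_def semiorder_of_permute_coords[OF assms(1), symmetric])

text \<open>The image is again a region, so the location of a single point determines which
  one.\<close>

lemma permute_region_of:
  fixes \<pi> :: "'n::finite \<Rightarrow> 'n"
  assumes \<pi>: "bij \<pi>" and r: "r \<in> generic_semiorders"
  shows "permute_region \<pi> (region_of r) = region_of (map_prod \<pi> \<pi> ` r)"
proof -
  have "permute_region \<pi> (region_of r) \<in> regions semiorder_arrangement"
    using r by (intro permute_region_regions[OF \<pi>]) (auto simp: regions_semiorder_arrangement)
  then obtain r' where r': "permute_region \<pi> (region_of r) = region_of r'"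
    by (auto simp: regions_semiorder_arrangement)
  obtain x where x: "x \<in> generic_points" "r = semiorder_of x"
    using r by (auto simp: generic_semiorders_def)
  then have "permute_coords \<pi> x \<in> region_of r'"
    unfolding r'[symmetric] by (auto simp: permute_region_def region_of_def)
  then show ?thesis
    using r' x semiorder_of_permute_coords[OF \<pi>, of x] by (simp add: region_of_def)
qed

lemma perm_rep_character_regions:
  fixes \<pi> :: "'n::finite \<Rightarrow> 'n"
  assumes \<pi>: "bij \<pi>"
  shows "perm_rep_character (regions semiorder_arrangement) permute_region \<pi>
    = of_nat (card {r \<in> generic_semiorders. map_prod \<pi> \<pi> ` r = r})"
proof -
  let ?R = "regions (semiorder_arrangement :: (real ^ 'n) set set)"
  have "finite ?R"
    unfolding regions_semiorder_arrangement by (rule finite_imageI) (rule finite)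
  then have "perm_rep_character ?R permute_region \<pi> = of_nat (card {R \<in> ?R. R = permute_region \<pi> R})"
    by (simp add: perm_rep_character_def perm_rep_matrix_def sum.If_cases Int_def)
  also have "{R \<in> ?R. R = permute_region \<pi> R} = region_of ` {r \<in> generic_semiorders. map_prod \<pi> \<pi> ` r = r}"
  proof -
    have "region_of r = permute_region \<pi> (region_of r) \<longleftrightarrow> map_prod \<pi> \<pi> ` r = r"
      if "r \<in> generic_semiorders" for r
      using region_of_inject[OF that] by (auto simp: permute_region_of[OF \<pi> that])
    then show ?thesis by (auto simp: regions_semiorder_arrangement)
  qed
  also have "card \<dots> = card {r \<in> generic_semiorders. map_prod \<pi> \<pi> ` r = r}"
    using region_of_inject by (intro card_image) (auto simp: inj_on_def)
  finally show ?thesis .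
qed

section \<open>Realizing Dyck paths by generic points\<close>

lemma finite_sets_separated:
  fixes L U :: "real set"
  assumes "finite L" "finite U" "\<And>l u. l \<in> L \<Longrightarrow> u \<in> U \<Longrightarrow> l < u"
  shows "\<exists>t. (\<forall>l\<in>L. l < t) \<and> (\<forall>u\<in>U. t < u)"
proof -
  consider "L = {}" | "U = {}" | "L \<noteq> {}" "U \<noteq> {}" by auto
  then show ?thesis
  proof cases
    case 1
    have "Min (insert 0 U) - 1 < u" if "u \<in> U" for u
    proof -
      have "Min (insert 0 U) \<le> u" using that assms(2) by (intro Min_le) auto
      then show ?thesis by linarith
    qed
    then show ?thesis using 1 by auto
  next
    case 2
    have "l < Max (insert 0 L) + 1" if "l \<in> L" for l
    proof -
      have "l \<le> Max (insert 0 L)" using that assms(1) by (intro Max_ge) auto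
      then show ?thesis by linarith
    qed
    then show ?thesis using 2 by auto
  next
    case 3
    then have "Max L < Min U" using assms by simp
    then obtain t where "Max L < t" "t < Min U" using dense by blast
    then show ?thesis using 3 assms by auto
  qed
qed

text \<open>Points are placed in increasing order. The last one has to exceed all earlier
  \<open>f i\<close> and those \<open>f i + 1\<close> with \<open>i < d n\<close>, and to stay below
  the other \<open>f i + 1\<close>; this is possible because \<open>f\<close> increases and
  \<open>d\<close> is monotone. Both inequalities are strict so that no difference of coordinates
  equals 1.\<close>

lemma realize_down_function:
  fixes d :: "nat \<Rightarrow> nat"
  assumes "\<And>i j. i \<le> j \<Longrightarrow> j < n \<Longrightarrow> d i \<le> d j" "\<And>j. j < n \<Longrightarrow> d j \<le> j"
  shows "\<exists>f :: nat \<Rightarrow> real. (\<forall>j<n. \<forall>i<j. f i < f j) \<and>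
    (\<forall>i<n. \<forall>j<n. (i < d j \<longrightarrow> f i + 1 < f j) \<and> (d j \<le> i \<longrightarrow> f j < f i + 1))"
  using assms
proof (induction n)
  case (Suc n)
  have mono: "\<And>i j. i \<le> j \<Longrightarrow> j < n \<Longrightarrow> d i \<le> d j" and below: "\<And>j. j < n \<Longrightarrow> d j \<le> j"
    using Suc.prems by auto
  obtain f :: "nat \<Rightarrow> real" where inc: "\<forall>j<n. \<forall>i<j. f i < f j"
    and f: "\<forall>i<n. \<forall>j<n. (i < d j \<longrightarrow> f i + 1 < f j) \<and> (d j \<le> i \<longrightarrow> f j < f i + 1)"
    using Suc.IH[OF mono below] by blast
  have dn: "d n \<le> n" and dle: "d i \<le> d n" if "i < n" for i
    using Suc.prems(1)[of i n] Suc.prems(2)[of n] that by auto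
  have "\<exists>t. (\<forall>l\<in>f ` {..<n} \<union> (\<lambda>i. f i + 1) ` {..<d n}. l < t) \<and> (\<forall>u\<in>(\<lambda>i. f i + 1) ` {d n..<n}. t < u)"
  proof (rule finite_sets_separated)
    fix l u assume l: "l \<in> f ` {..<n} \<union> (\<lambda>i. f i + 1) ` {..<d n}" and u: "u \<in> (\<lambda>i. f i + 1) ` {d n..<n}"
    from u obtain k where k: "u = f k + 1" "d n \<le> k" "k < n" by auto
    from l consider i where "l = f i" "i < n" | i where "l = f i + 1" "i < d n" by auto
    then show "l < u"
    proof cases
      case 1
      then have "d i \<le> k" using dle[of i] k by simp
      then show ?thesis using f 1 k by simp
    next
      case 2
      then show ?thesis using inc k by simp
    qed
  qed simp_all
  then obtain t where "\<forall>l\<in>f ` {..<n} \<union> (\<lambda>i. f i + 1) ` {..<d n}. l < t"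
      "\<forall>u\<in>(\<lambda>i. f i + 1) ` {d n..<n}. t < u"
    by blast
  then have t: "\<And>i. i < n \<Longrightarrow> f i < t" "\<And>i. i < d n \<Longrightarrow> f i + 1 < t"
      "\<And>i. d n \<le> i \<Longrightarrow> i < n \<Longrightarrow> t < f i + 1"
    by auto
  define g where "g = f(n := t)"
  have g: "g n = t" "\<And>i. i < n \<Longrightarrow> g i = f i" by (simp_all add: g_def)
  have "\<forall>j<Suc n. \<forall>i<j. g i < g j"
    using inc t(1) by (auto simp: less_Suc_eq g)
  moreover have "(i < d j \<longrightarrow> g i + 1 < g j) \<and> (d j \<le> i \<longrightarrow> g j < g i + 1)"
    if "i < Suc n" "j < Suc n" for i j
  proof -
    consider "i < n" "j < n" | "i < n" "j = n" | "i = n" "j < n" | "i = n" "j = n"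
      using \<open>i < Suc n\<close> \<open>j < Suc n\<close> by linarith
    then show ?thesis
    proof cases
      case 1
      then show ?thesis using f by (simp add: g)
    next
      case 2
      then show ?thesis using t by (simp add: g)
    next
      case 3
      then have "g j < g i + 1" using t(1)[of j] by (simp add: g)
      then show ?thesis using below[of j] 3 by simp
    next
      case 4
      then show ?thesis using Suc.prems(2)[of n] by simp
    qed
  qed
  ultimately show ?case by blast
qed simp

lemma model_relation_generic:
  fixes e :: "'n::finite \<Rightarrow> nat"
  assumes e: "bij_betw e UNIV {..<CARD('n)}" and d: "d \<in> down_lists CARD('n)"
  shows "{(i, j). e i < d ! e j} \<in> generic_semiorders"
proof -
  have "d ! i \<le> d ! j" if "i \<le> j" "j < CARD('n)" for i j
    using d that by (auto simp: down_lists_def intro: sorted_nth_mono)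
  moreover have "d ! j \<le> j" if "j < CARD('n)" for j
    using d that by (auto simp: down_lists_def)
  ultimately have "\<exists>f :: nat \<Rightarrow> real. (\<forall>j<CARD('n). \<forall>i<j. f i < f j) \<and>
    (\<forall>i<CARD('n). \<forall>j<CARD('n). (i < d ! j \<longrightarrow> f i + 1 < f j) \<and> (d ! j \<le> i \<longrightarrow> f j < f i + 1))"
    by (rule realize_down_function)
  then obtain f :: "nat \<Rightarrow> real" where f: "\<forall>i<CARD('n). \<forall>j<CARD('n).
      (i < d ! j \<longrightarrow> f i + 1 < f j) \<and> (d ! j \<le> i \<longrightarrow> f j < f i + 1)"
    by (elim exE conjE)
  have en: "e i < CARD('n)" for i using e by (auto simp: bij_betw_def)
  define x :: "real ^ 'n" where "x = (\<chi> i. f (e i))"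
  have rel: "x $ i + 1 < x $ j \<longleftrightarrow> e i < d ! e j" "x $ j - x $ i \<noteq> 1" for i j
    using f[rule_format, OF en[of i] en[of j]] by (cases "e i < d ! e j"; force simp: x_def not_less)+
  then have "semiorder_of x = {(i, j). e i < d ! e j}"
    by (simp add: semiorder_of_def)
  moreover have "x \<in> generic_points" using rel(2) by (simp add: mem_generic_points)
  ultimately show ?thesis by (auto simp: generic_semiorders_def)
qed

text \<open>The term of a permutation is the number of semiorders it fixes times the number of
  colourings of content \<open>m\<close> it fixes. The sum thus counts fixed pairs, and the factor
  1/n! of the characteristic cancels the n! of Burnside's count.\<close>

lemma coeff_at_frobenius_regions:
  assumes m: "0 \<notin># m" "size m = CARD('n)"
  shows "coeff_at (frobenius_characteristic (UNIV :: 'n::finite set)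
      (perm_rep_character (regions (semiorder_arrangement :: (real ^ 'n) set set)) permute_region)) m
    = of_nat (card {(d, w) \<in> normal_pairs CARD('n). mset w = m})"
proof -
  let ?n = "CARD('n)"
  obtain e :: "'n \<Rightarrow> nat" where e: "bij_betw e UNIV {..<?n}"
    using ex_bij_betw_finite_nat[of "UNIV :: 'n set"] by (auto simp: atLeast0LessThan)
  define Col where "Col = {c :: 'n \<Rightarrow> nat. (\<forall>i. c i \<ge> 1) \<and> image_mset c (mset_set UNIV) = m}"
  define NP where "NP = {(d, w) \<in> normal_pairs ?n. mset w = m}"
  define Y where "Y = (generic_semiorders :: 'n rel set) \<times> Col"
  define A where "A \<pi> = {r \<in> generic_semiorders. map_prod \<pi> \<pi> ` r = r}" for \<pi> :: "'n \<Rightarrow> 'n"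
  define B where "B \<pi> = {c \<in> Col. c \<circ> \<pi> = c}" for \<pi> :: "'n \<Rightarrow> 'n"
  have "Col \<subseteq> UNIV \<rightarrow>\<^sub>E set_mset m"
    by (auto simp: Col_def)
  then have "finite Col"
    by (rule finite_subset) (simp add: finite_PiE)
  have content_inv: "image_mset (c \<circ> inv \<pi>) (mset_set UNIV) = image_mset c (mset_set UNIV)"
    if "bij \<pi>" for \<pi> :: "'n \<Rightarrow> 'n" and c :: "'n \<Rightarrow> nat"
  proof -
    have "image_mset (inv \<pi>) (mset_set UNIV) = mset_set UNIV"
      using bij_imp_bij_inv[OF that] by (simp add: image_mset_mset_set bij_def)
    then show ?thesis by (metis multiset.map_comp)
  qed
  have content_model: "image_mset (\<lambda>i. w ! e i) (mset_set UNIV) = mset w" if "length w = ?n" for w :: "nat list"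
  proof -
    have "image_mset (\<lambda>i. w ! e i) (mset_set UNIV) = image_mset (nth w) (image_mset e (mset_set UNIV))"
      by (simp add: multiset.map_comp o_def)
    also have "image_mset e (mset_set UNIV) = mset_set {..<?n}"
      using e by (simp add: image_mset_mset_set bij_betw_def)
    also have "image_mset (nth w) (mset_set {..<?n}) = mset (map (nth w) [0..<length w])"
      using that by (simp add: atLeast0LessThan mset_upt)
    finally show ?thesis by (simp add: map_nth)
  qed
  have fixed: "coloured_act \<pi> (r, c) = (r, c) \<longleftrightarrow> map_prod \<pi> \<pi> ` r = r \<and> c \<circ> \<pi> = c"
    if "bij \<pi>" for \<pi> :: "'n \<Rightarrow> 'n" and r c
  proof -
    have "c \<circ> inv \<pi> = c \<longleftrightarrow> c \<circ> \<pi> = c"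
      using that by (metis bij_is_inj bij_is_surj comp_assoc comp_id inv_o_cancel surj_iff)
    then show ?thesis by (simp add: coloured_act_def)
  qed
  have "card {(\<pi>, y). bij \<pi> \<and> y \<in> Y \<and> coloured_act \<pi> y = y} = fact ?n * card (model e ` NP)"
  proof (rule card_fixed_pairs_transversal)
    show "coloured_act \<pi> y \<in> Y" if "bij \<pi>" "y \<in> Y" for \<pi> :: "'n \<Rightarrow> 'n" and y
      using that content_inv[OF \<open>bij \<pi>\<close>] generic_semiorders_closed[OF \<open>bij \<pi>\<close>]
      by (auto simp: Y_def Col_def coloured_act_def)
    show "model e ` NP \<subseteq> Y"
    proof (rule image_subsetI)
      fix p assume p: "p \<in> NP"
      obtain d w where dw_def: "p = (d, w)" by (cases p)
      with p have dw: "d \<in> down_lists ?n" "length w = ?n" "mset w = m"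
        by (auto simp: NP_def normal_pairs_def)
      have "w ! e i \<ge> 1" for i
      proof -
        have "e i < length w" using dw(2) bij_betwE[OF e] by simp
        then have "w ! e i \<in> set w" by simp
        then have "w ! e i \<in># m" using dw(3) by (metis set_mset_mset)
        then show ?thesis using m(1) by (cases "w ! e i") auto
      qed
      then show "model e p \<in> Y"
        unfolding dw_def using dw model_relation_generic[OF e dw(1)] content_model[OF dw(2)]
        by (simp add: Y_def Col_def model_def)
    qed
    show "\<exists>\<pi> t. bij \<pi> \<and> t \<in> model e ` NP \<and> coloured_act \<pi> t = y" if y_in: "y \<in> Y" for y
    proof -
      obtain x c where y: "y = (semiorder_of x, c)" and c: "c \<in> Col"
        using y_in by (auto simp: Y_def generic_semiorders_def)
      have "\<exists>\<pi> d w. bij \<pi> \<and> (d, w) \<in> normal_pairs ?n \<and> coloured_act \<pi> (model e (d, w)) = (semiorder_of x, c)"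
        by (rule model_exists[OF e, where f = "($) x"]) (simp add: semiorder_of_def)
      then obtain \<pi> d w where \<pi>: "bij \<pi>" and dw: "(d, w) \<in> normal_pairs ?n"
        and act: "coloured_act \<pi> (model e (d, w)) = (semiorder_of x, c)" by blast
      have "c = (\<lambda>i. w ! e i) \<circ> inv \<pi>" using act by (simp add: coloured_act_def model_def)
      then have "image_mset c (mset_set UNIV) = mset w"
        using content_inv[OF \<pi>] content_model[of w] dw by (simp add: normal_pairs_def)
      then have "(d, w) \<in> NP" using c dw by (simp add: NP_def Col_def)
      then show ?thesis using \<pi> act y by blast
    qed
    show "s = t" if "bij \<pi>" "s \<in> model e ` NP" "t \<in> model e ` NP" "coloured_act \<pi> s = t"
      for \<pi> :: "'n \<Rightarrow> 'n" and s t
      using that model_unique[OF e \<open>bij \<pi>\<close>] by (auto simp: NP_def) blast+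
  qed (rule coloured_act_comp coloured_act_id; assumption)+
  also have "card (model e ` NP) = card NP"
  proof (rule card_image, rule inj_onI, clarify)
    fix d w d' w' assume "(d, w) \<in> NP" "(d', w') \<in> NP" "model e (d, w) = model e (d', w')"
    then show "d = d' \<and> w = w'"
      by (intro model_unique[OF e bij_id]) (auto simp: NP_def coloured_act_id)
  qed
  also have "{(\<pi>, y). bij \<pi> \<and> y \<in> Y \<and> coloured_act \<pi> y = y} = (SIGMA \<pi>:{\<pi>. bij \<pi>}. A \<pi> \<times> B \<pi>)"
  proof (rule set_eqI)
    fix p :: "('n \<Rightarrow> 'n) \<times> ('n rel \<times> ('n \<Rightarrow> nat))"
    obtain \<pi> r c where p: "p = (\<pi>, (r, c))" by (metis surj_pair)
    show "p \<in> {(\<pi>, y). bij \<pi> \<and> y \<in> Y \<and> coloured_act \<pi> y = y} \<longleftrightarrow> p \<in> (SIGMA \<pi>:{\<pi>. bij \<pi>}. A \<pi> \<times> B \<pi>)"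
      using fixed[of \<pi> r c] unfolding p Y_def A_def B_def by simp blast
  qed
  also have "card \<dots> = (\<Sum>\<pi> | bij \<pi>. card (A \<pi>) * card (B \<pi>))"
    using \<open>finite Col\<close> by (simp add: A_def B_def card_cartesian_product)
  finally have count: "(\<Sum>\<pi> | bij \<pi>. card (A \<pi>) * card (B \<pi>)) = fact ?n * card NP" .
  have "coeff_at (frobenius_characteristic (UNIV :: 'n set)
      (perm_rep_character (regions (semiorder_arrangement :: (real ^ 'n) set set)) permute_region)) m
      = 1 / fact ?n * (\<Sum>\<pi> | bij \<pi>. of_nat (card (A \<pi>)) * of_nat (card (B \<pi>)))"
  proof -
    have B: "B \<pi> = {c. (\<forall>i. c i \<ge> 1) \<and> c \<circ> \<pi> = c \<and> image_mset c (mset_set UNIV) = m}" for \<pi>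
      by (auto simp: B_def Col_def)
    have "{\<pi> :: 'n \<Rightarrow> 'n. \<pi> permutes UNIV} = {\<pi>. bij \<pi>}" by (simp add: permutes_univ bij_iff)
    then show ?thesis
      by (simp add: frobenius_characteristic_def coeff_at_sum perm_rep_character_regions
          coeff_at_prod_cycle_type A_def B)
  qed
  also have "\<dots> = 1 / fact ?n * of_nat (\<Sum>\<pi> | bij \<pi>. card (A \<pi>) * card (B \<pi>))"
    by simp
  also have "\<dots> = of_nat (card NP)" unfolding count by simp
  finally show ?thesis by (simp add: NP_def)
qed

text \<open>Every power sum product counts colourings of the whole index type by positive colours,
  which have no other content.\<close>

lemma coeff_at_frobenius_eq_0:
  assumes "0 \<in># m \<or> size m \<noteq> CARD('n)"
  shows "coeff_at (frobenius_characteristic (UNIV :: 'n::finite set) f) m = 0"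
proof -
  have "{c :: 'n \<Rightarrow> nat. (\<forall>i. c i \<ge> 1) \<and> c \<circ> \<pi> = c \<and> image_mset c (mset_set UNIV) = m} = {}" for \<pi>
  proof -
    have "0 \<notin># m" "size m = CARD('n)"
      if "\<forall>i. c i \<ge> 1" "image_mset c (mset_set UNIV) = m" for c :: "'n \<Rightarrow> nat"
    proof -
      have "c i \<noteq> 0" for i using that(1)[rule_format, of i] by simp
      then have "0 \<notin> range c" by (metis rangeE)
      then show "0 \<notin># m" by (simp add: that(2)[symmetric])
      show "size m = CARD('n)" by (simp add: that(2)[symmetric])
    qed
    then show ?thesis using assms by blast
  qed
  then have "coeff_at (\<Prod>k\<in>#cycle_type UNIV \<pi>. power_sum k :: complex mseries) m = 0"
    if "\<pi> permutes UNIV" for \<pi> :: "'n \<Rightarrow> 'n"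
    unfolding coeff_at_prod_cycle_type[OF permutes_bij[OF that]] by (simp only: card.empty of_nat_0)
  then show ?thesis
    by (simp add: frobenius_characteristic_def coeff_at_sum)
qed

text \<open>In the factorization of \<zeta>^6 - 1 into \<zeta>^3 - 1, \<zeta> + 1 and \<zeta>^2 -
  \<zeta> + 1, primitivity rules out the first two; dividing the third by \<zeta> gives the
  sum.\<close>

lemma primitive_sixth_root:
  assumes "primitive_root_of_unity 6 \<zeta>"
  shows "inverse \<zeta> + \<zeta> = 1" "inverse \<zeta> * \<zeta> = 1"
proof -
  have z6: "\<zeta> ^ 6 = 1" and z: "\<zeta> ^ 2 \<noteq> 1" "\<zeta> ^ 3 \<noteq> 1"
    using assms by (auto simp: primitive_root_of_unity_def)
  then have "\<zeta> \<noteq> 0" by auto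
  then show "inverse \<zeta> * \<zeta> = 1" by simp
  have "(\<zeta> ^ 3 - 1) * ((\<zeta> + 1) * (\<zeta> ^ 2 - \<zeta> + 1)) = \<zeta> ^ 6 - 1"
    by (simp add: algebra_simps power_numeral_reduce)
  then have "\<zeta> + 1 = 0 \<or> \<zeta> ^ 2 - \<zeta> + 1 = 0" using z6 z by simp
  moreover have "\<zeta> + 1 \<noteq> 0"
  proof
    assume "\<zeta> + 1 = 0"
    then have "\<zeta> = - 1" by (simp add: eq_neg_iff_add_eq_0)
    then show False using z by simp
  qed
  ultimately have "\<zeta> * (inverse \<zeta> + \<zeta>) = \<zeta> * 1"
    using \<open>\<zeta> \<noteq> 0\<close> by (simp add: algebra_simps power2_eq_square)
  then show "inverse \<zeta> + \<zeta> = 1" using \<open>\<zeta> \<noteq> 0\<close> by simp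
qed

theorem theorem1p7:
  fixes \<zeta> :: complex and n :: nat
  assumes "n = CARD('n::finite)"
    and "primitive_root_of_unity 6 \<zeta>"
  shows "frobenius_characteristic (UNIV :: 'n set)
           (perm_rep_character
              (regions (semiorder_arrangement :: (real ^ 'n) set set)) permute_region)
         = G_series n 1 (inverse \<zeta>) 1 \<zeta>"
proof (rule mseries_eqI)
  fix m
  show "coeff_at (frobenius_characteristic (UNIV :: 'n set)
           (perm_rep_character
              (regions (semiorder_arrangement :: (real ^ 'n) set set)) permute_region)) m
      = coeff_at (G_series n 1 (inverse \<zeta>) 1 \<zeta>) m"
  proof (cases "0 \<in># m \<or> size m \<noteq> n")
    \<comment> \<open>Both sides are homogeneous of degree \<open>n\<close> and free of the index 0,
      so both coefficients vanish.\<close>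
    case True
    then have no_trees: "{T. T \<in> labeled_trees n \<and> mset_tree T = m} = {}"
      by (force simp: labeled_trees_def)
    show ?thesis
      unfolding G_series.rep_eq no_trees using True assms(1) by (simp add: coeff_at_frobenius_eq_0)
  next
    case False
    then show ?thesis
      using coeff_at_frobenius_regions[where 'n = 'n, of m]
        coeff_at_G_series[OF primitive_sixth_root[OF assms(2)], of m] assms(1) by simp
  qed
qed

end
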